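(* Let $\mathcal B$ be a bicategory. A horizontal arrow $$A_0\xrightarrow{f_1}\cdots\xrightarrow{f_{i_0}}[A_{i_0}]\xrightarrow{f_{i_0+1}}\cdots\xrightarrow{f_{i_1}}[A_{i_1}]\xrightarrow{f_{i_1+1}}\cdots\xrightarrow{f_n}A_n$$ in the double category $\mathbf{Dbl}(\mathcal B)$ of marked paths is a pre-companion if and only if the chosen composition $\varphi_{f_{i_0+1}\cdots f_{i_1}}$ is an equivalence in $\mathcal B$.
   Context: **Companions and pre-companions.** In a double category, $\mathrm{Id}_A$ is the horizontal identity arrow and $1_A$ the vertical identity arrow on $A$, $1_f$ is the vertical identity cell on a horizontal arrow $f$, $\mathrm{id}_v$ the horizontal identity cell on a vertical arrow $v$, $\circ$ is horizontal and $\cdot$ vertical composition. A horizontal arrow $f:A\to B$ and a vertical arrow $v$ from $A$ to $B$ are companions if there are double cells $\psi$ (top $\mathrm{Id}_A$, left $1_A$, right $v$, bottom $f$) and $\chi$ (top $f$, left $v$, right $1_B$, bottom $\mathrm{Id}_B$) with $\chi\circ\psi=1_f$ and $\chi\cdot\psi=\mathrm{id}_v$; a horizontal arrow "is a companion" if it has a vertical companion. A horizontal arrow $f:A\to B$ in a weakly globular double category is a left pre-companion if there are horizontal arrows $f':A'\to B'$ and $r_f:B'\to C$ and a vertically invertible double cell with top $f$ and bottom $f'$, such that $r_f\circ f'$ is a companion; a right pre-companion if there are horizontal arrows $f'':A''\to B''$ and $l_f:D\to A''$ and a vertically invertible double cell with top $f$ and bottom $f''$, such that $f''\circ l_f$ is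 a companion; and a pre-companion if it is both. **The double category $\mathbf{Dbl}(\mathcal B)$ of marked paths** (a weakly globular double category). Choose for each finite path $A_0\xrightarrow{f_1}A_1\to\cdots\xrightarrow{f_n}A_n$ of composable arrows in $\mathcal B$ a composite $\varphi_{f_1\cdots f_n}$ (a bracketing of the path, with $\varphi_{A_0}=1_{A_0}$ for the empty path at $A_0$ and $\varphi_f=f$). For a concatenation of paths, the associativity and unit cells give unique invertible comparison 2-cells $\Phi$ between the composite of the chosen composites and the chosen composite of the concatenation. - Objects: pairs $(A_0\xrightarrow{f_1}\cdots\xrightarrow{f_n}A_n;\,i_0)$ of a finite path in $\mathcal B$ ($n\ge0$) and $0\le i_0\le n$ (a marked object $[A_{i_0}]$). - Vertical arrows: there is a unique vertical arrow from $(A_0\to\cdots\to A_n;i_0)$ to $(B_0\to\cdots\to B_m;j_0)$ if $A_{i_0}=B_{j_0}$, and none otherwise. - Horizontal arrows: $(A_0\xrightarrow{f_1}\cdots\xrightarrow{f_n}A_n;\,i_0,i_1)$ with $i_0\le i_1$, with domain the same path marked at $i_0$ and codomain the same path marked at $i_1$; two are composable iff the paths agree and the marks match, with composite $(\ldots;i_0,i_1)$ followed by $(\ldots;i_1,i_2)$ equal to $(\ldots;i_0,i_2)$. - Double cells with top $(A_0\xrightarrow{f_1}\cdots A_n;i_0,i_1)$ and bottom $(B_0\xrightarrow{g_1}\cdots B_m;j_0,j_1)$ exist only when $A_{i_0}=B_{j_0}$, $A_{i_1}=B_{j_1}$, and are then 2-cells $\alpha:\varphi_{f_{i_0+1}\cdots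 f_{i_1}}\Rightarrow\varphi_{g_{j_0+1}\cdots g_{j_1}}$ in $\mathcal B$. Vertical composition is vertical composition of 2-cells; the horizontal composite of $\alpha$ and $\beta$ is the horizontal composite of the 2-cells in $\mathcal B$ conjugated by the comparison 2-cells $\Phi$. An equivalence in a bicategory is an arrow $f:A\to B$ for which there is $g:B\to A$ with $gf\cong1_A$ and $fg\cong1_B$. *)

theory Defs
  imports Main
begin

section \<open>Bicategories\<close>

text \<open>
  One-cells are called arrows. Both the composition of arrows and the two compositions of
  2-cells are written in the order of function composition: the right operand comes first.
\<close>

record ('o, 'a, 'c) bicat =
  Obj :: "'o set"
  Arr :: "'a set"
  src :: "'a \<Rightarrow> 'o"
  trg :: "'a \<Rightarrow> 'o"
  Cell :: "'c set"
  cdom :: "'c \<Rightarrow> 'a"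
  ccod :: "'c \<Rightarrow> 'a"
  one :: "'o \<Rightarrow> 'a"  (\<open>\<one>\<index>\<close>)
  comp :: "'a \<Rightarrow> 'a \<Rightarrow> 'a"  (infixr \<open>\<odot>\<index>\<close> 70)
  cid :: "'a \<Rightarrow> 'c"  (\<open>\<iota>\<index>\<close>)
  vcomp :: "'c \<Rightarrow> 'c \<Rightarrow> 'c"  (infixr \<open>\<cdot>\<index>\<close> 60)
  hcomp :: "'c \<Rightarrow> 'c \<Rightarrow> 'c"  (infixr \<open>\<star>\<index>\<close> 70)
  assoc :: "'a \<Rightarrow> 'a \<Rightarrow> 'a \<Rightarrow> 'c"  (\<open>\<a>\<index>\<close>)
  lunit :: "'a \<Rightarrow> 'c"  (\<open>\<l>\<index>\<close>)
  runit :: "'a \<Rightarrow> 'c"  (\<open>\<r>\<index>\<close>)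

definition hom :: "('o, 'a, 'c, 'z) bicat_scheme \<Rightarrow> 'o \<Rightarrow> 'o \<Rightarrow> 'a set"
  where "hom B X Y = {f \<in> Arr B. src B f = X \<and> trg B f = Y}"

definition cells :: "('o, 'a, 'c, 'z) bicat_scheme \<Rightarrow> 'a \<Rightarrow> 'a \<Rightarrow> 'c set"
  where "cells B f g = {\<alpha> \<in> Cell B. cdom B \<alpha> = f \<and> ccod B \<alpha> = g}"

definition inverse_cells :: "('o, 'a, 'c, 'z) bicat_scheme \<Rightarrow> 'c \<Rightarrow> 'c \<Rightarrow> bool"
  where "inverse_cells B \<alpha> \<beta> \<longleftrightarrow>
    \<alpha> \<in> Cell B \<and> \<beta> \<in> cells B (ccod B \<alpha>) (cdom B \<alpha>) \<and>
    \<beta> \<cdot>\<^bsub>B\<^esub> \<alpha> = \<iota>\<^bsub>B\<^esub> (cdom B \<alpha>) \<and> \<alpha> \<cdot>\<^bsub>B\<^esub> \<beta> = \<iota>\<^bsub>B\<^esub> (ccod B \<alpha>)"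

definition iso_cells :: "('o, 'a, 'c, 'z) bicat_scheme \<Rightarrow> 'a \<Rightarrow> 'a \<Rightarrow> 'c set"
  where "iso_cells B f g = {\<alpha> \<in> cells B f g. \<exists>\<beta>. inverse_cells B \<alpha> \<beta>}"

definition cell_inv :: "('o, 'a, 'c, 'z) bicat_scheme \<Rightarrow> 'c \<Rightarrow> 'c"
  where "cell_inv B \<alpha> = (THE \<beta>. inverse_cells B \<alpha> \<beta>)"

locale bicategory =
  fixes B :: "('o, 'a, 'c, 'z) bicat_scheme" (structure)
  assumes arr_bounds: "f \<in> Arr B \<Longrightarrow> src B f \<in> Obj B \<and> trg B f \<in> Obj B"
    and cell_bounds: "\<alpha> \<in> Cell B \<Longrightarrow>
      cdom B \<alpha> \<in> Arr B \<and> ccod B \<alpha> \<in> Arr B \<and>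
      src B (cdom B \<alpha>) = src B (ccod B \<alpha>) \<and> trg B (cdom B \<alpha>) = trg B (ccod B \<alpha>)"
    and cid_cell: "f \<in> Arr B \<Longrightarrow> \<iota> f \<in> cells B f f"
    and vcomp_cell: "\<lbrakk>\<alpha> \<in> cells B f g; \<beta> \<in> cells B g h\<rbrakk> \<Longrightarrow> \<beta> \<cdot> \<alpha> \<in> cells B f h"
    and vcomp_cid_left: "\<alpha> \<in> cells B f g \<Longrightarrow> \<iota> g \<cdot> \<alpha> = \<alpha>"
    and vcomp_cid_right: "\<alpha> \<in> cells B f g \<Longrightarrow> \<alpha> \<cdot> \<iota> f = \<alpha>"
    and vcomp_assoc: "\<lbrakk>\<alpha> \<in> cells B f g; \<beta> \<in> cells B g h; \<gamma> \<in> cells B h k\<rbrakk> \<Longrightarrow>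
      (\<gamma> \<cdot> \<beta>) \<cdot> \<alpha> = \<gamma> \<cdot> (\<beta> \<cdot> \<alpha>)"
    and one_hom: "X \<in> Obj B \<Longrightarrow> \<one> X \<in> hom B X X"
    and comp_hom: "\<lbrakk>f \<in> hom B X Y; g \<in> hom B Y Z\<rbrakk> \<Longrightarrow> g \<odot> f \<in> hom B X Z"
    and hcomp_cell: "\<lbrakk>\<alpha> \<in> cells B f f'; \<beta> \<in> cells B g g'; trg B f = src B g\<rbrakk> \<Longrightarrow>
      \<beta> \<star> \<alpha> \<in> cells B (g \<odot> f) (g' \<odot> f')"
    and hcomp_cid: "\<lbrakk>f \<in> hom B X Y; g \<in> hom B Y Z\<rbrakk> \<Longrightarrow> \<iota> g \<star> \<iota> f = \<iota> (g \<odot> f)"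
    and interchange: "\<lbrakk>\<alpha> \<in> cells B f f'; \<alpha>' \<in> cells B f' f'';
        \<beta> \<in> cells B g g'; \<beta>' \<in> cells B g' g''; trg B f = src B g\<rbrakk> \<Longrightarrow>
      (\<beta>' \<cdot> \<beta>) \<star> (\<alpha>' \<cdot> \<alpha>) = (\<beta>' \<star> \<alpha>') \<cdot> (\<beta> \<star> \<alpha>)"
    and assoc_cell: "\<lbrakk>f \<in> hom B W X; g \<in> hom B X Y; h \<in> hom B Y Z\<rbrakk> \<Longrightarrow>
      \<a> h g f \<in> iso_cells B ((h \<odot> g) \<odot> f) (h \<odot> (g \<odot> f))"
    and assoc_natural: "\<lbrakk>\<alpha> \<in> cells B f f'; \<beta> \<in> cells B g g'; \<gamma> \<in> cells B h h';
        trg B f = src B g; trg B g = src B h\<rbrakk> \<Longrightarrow>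
      \<a> h' g' f' \<cdot> ((\<gamma> \<star> \<beta>) \<star> \<alpha>) = (\<gamma> \<star> (\<beta> \<star> \<alpha>)) \<cdot> \<a> h g f"
    and lunit_cell: "f \<in> hom B X Y \<Longrightarrow> \<l> f \<in> iso_cells B (\<one> Y \<odot> f) f"
    and lunit_natural: "\<lbrakk>\<alpha> \<in> cells B f f'; trg B f = Y\<rbrakk> \<Longrightarrow>
      \<l> f' \<cdot> (\<iota> (\<one> Y) \<star> \<alpha>) = \<alpha> \<cdot> \<l> f"
    and runit_cell: "f \<in> hom B X Y \<Longrightarrow> \<r> f \<in> iso_cells B (f \<odot> \<one> X) f"
    and runit_natural: "\<lbrakk>\<alpha> \<in> cells B f f'; src B f = X\<rbrakk> \<Longrightarrow>
      \<r> f' \<cdot> (\<alpha> \<star> \<iota> (\<one> X)) = \<alpha> \<cdot> \<r> f"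
    and pentagon: "\<lbrakk>f \<in> hom B V W; g \<in> hom B W X; h \<in> hom B X Y; k \<in> hom B Y Z\<rbrakk> \<Longrightarrow>
      (\<iota> k \<star> \<a> h g f) \<cdot> (\<a> k (h \<odot> g) f \<cdot> (\<a> k h g \<star> \<iota> f)) =
      \<a> k h (g \<odot> f) \<cdot> \<a> (k \<odot> h) g f"
    and triangle: "\<lbrakk>f \<in> hom B X Y; g \<in> hom B Y Z\<rbrakk> \<Longrightarrow>
      (\<iota> g \<star> \<l> f) \<cdot> \<a> g (\<one> Y) f = \<r> g \<star> \<iota> f"

definition isomorphic_arrows :: "('o, 'a, 'c, 'z) bicat_scheme \<Rightarrow> 'a \<Rightarrow> 'a \<Rightarrow> bool"
  where "isomorphic_arrows B f g \<longleftrightarrow> iso_cells B f g \<noteq> {}"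

definition is_equivalence :: "('o, 'a, 'c, 'z) bicat_scheme \<Rightarrow> 'a \<Rightarrow> bool"
  where "is_equivalence B f \<longleftrightarrow> f \<in> Arr B \<and>
    (\<exists>g \<in> hom B (trg B f) (src B f).
       isomorphic_arrows B (g \<odot>\<^bsub>B\<^esub> f) (\<one>\<^bsub>B\<^esub> (src B f)) \<and>
       isomorphic_arrows B (f \<odot>\<^bsub>B\<^esub> g) (\<one>\<^bsub>B\<^esub> (trg B f)))"


section \<open>Double categories, companions and pre-companions\<close>

text \<open>
  A square has a top and a bottom (horizontal arrows) and a left and a right side (vertical
  arrows). Vertical arrows and vertical composition run from top to bottom. All compositions
  are written in the order of function composition, so \<open>sq_vcomp D \<tau> \<sigma>\<close> places \<open>\<tau>\<close> below
  \<open>\<sigma>\<close>, and \<open>sq_hcomp D \<tau> \<sigma>\<close> places \<open>\<tau>\<close> to the right of \<open>\<sigma>\<close>.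
\<close>

record ('o, 'h, 'v, 's) dblcat =
  dobj :: "'o set"
  harr :: "'h set"
  hdom :: "'h \<Rightarrow> 'o"
  hcod :: "'h \<Rightarrow> 'o"
  harr_id :: "'o \<Rightarrow> 'h"
  harr_comp :: "'h \<Rightarrow> 'h \<Rightarrow> 'h"
  varr :: "'v set"
  vdom :: "'v \<Rightarrow> 'o"
  vcod :: "'v \<Rightarrow> 'o"
  varr_id :: "'o \<Rightarrow> 'v"
  varr_comp :: "'v \<Rightarrow> 'v \<Rightarrow> 'v"
  squares :: "'s set"
  sq_top :: "'s \<Rightarrow> 'h"
  sq_bottom :: "'s \<Rightarrow> 'h"
  sq_left :: "'s \<Rightarrow> 'v"
  sq_right :: "'s \<Rightarrow> 'v"
  sq_vid :: "'h \<Rightarrow> 's"  \<comment> \<open>vertical identity square on a horizontal arrow\<close>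
  sq_hid :: "'v \<Rightarrow> 's"  \<comment> \<open>horizontal identity square on a vertical arrow\<close>
  sq_vcomp :: "'s \<Rightarrow> 's \<Rightarrow> 's"
  sq_hcomp :: "'s \<Rightarrow> 's \<Rightarrow> 's"

definition companions :: "('o, 'h, 'v, 's, 'z) dblcat_scheme \<Rightarrow> 'h \<Rightarrow> 'v \<Rightarrow> bool"
  where "companions D f v \<longleftrightarrow>
    f \<in> harr D \<and> v \<in> varr D \<and> vdom D v = hdom D f \<and> vcod D v = hcod D f \<and>
    (\<exists>\<psi> \<in> squares D. \<exists>\<chi> \<in> squares D.
       sq_top D \<psi> = harr_id D (hdom D f) \<and> sq_left D \<psi> = varr_id D (hdom D f) \<and>
       sq_right D \<psi> = v \<and> sq_bottom D \<psi> = f \<and>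
       sq_top D \<chi> = f \<and> sq_left D \<chi> = v \<and>
       sq_right D \<chi> = varr_id D (hcod D f) \<and> sq_bottom D \<chi> = harr_id D (hcod D f) \<and>
       sq_hcomp D \<chi> \<psi> = sq_vid D f \<and> sq_vcomp D \<chi> \<psi> = sq_hid D v)"

definition is_companion :: "('o, 'h, 'v, 's, 'z) dblcat_scheme \<Rightarrow> 'h \<Rightarrow> bool"
  where "is_companion D f \<longleftrightarrow> (\<exists>v. companions D f v)"

definition vertically_invertible :: "('o, 'h, 'v, 's, 'z) dblcat_scheme \<Rightarrow> 's \<Rightarrow> bool"
  where "vertically_invertible D \<sigma> \<longleftrightarrow> \<sigma> \<in> squares D \<and>
    (\<exists>\<tau> \<in> squares D. sq_top D \<tau> = sq_bottom D \<sigma> \<and> sq_bottom D \<tau> = sq_top D \<sigma> \<and>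
       sq_vcomp D \<tau> \<sigma> = sq_vid D (sq_top D \<sigma>) \<and> sq_vcomp D \<sigma> \<tau> = sq_vid D (sq_bottom D \<sigma>))"

definition left_pre_companion :: "('o, 'h, 'v, 's, 'z) dblcat_scheme \<Rightarrow> 'h \<Rightarrow> bool"
  where "left_pre_companion D f \<longleftrightarrow> f \<in> harr D \<and>
    (\<exists>f' \<in> harr D. \<exists>r \<in> harr D. \<exists>\<sigma>. hdom D r = hcod D f' \<and>
       vertically_invertible D \<sigma> \<and> sq_top D \<sigma> = f \<and> sq_bottom D \<sigma> = f' \<and>
       is_companion D (harr_comp D r f'))"

definition right_pre_companion :: "('o, 'h, 'v, 's, 'z) dblcat_scheme \<Rightarrow> 'h \<Rightarrow> bool"
  where "right_pre_companion D f \<longleftrightarrow> f \<in> harr D \<and>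
    (\<exists>f'' \<in> harr D. \<exists>l \<in> harr D. \<exists>\<sigma>. hcod D l = hdom D f'' \<and>
       vertically_invertible D \<sigma> \<and> sq_top D \<sigma> = f \<and> sq_bottom D \<sigma> = f'' \<and>
       is_companion D (harr_comp D f'' l))"

definition pre_companion :: "('o, 'h, 'v, 's, 'z) dblcat_scheme \<Rightarrow> 'h \<Rightarrow> bool"
  where "pre_companion D f \<longleftrightarrow> left_pre_companion D f \<and> right_pre_companion D f"


section \<open>Paths, bracketings and comparison cells\<close>

text \<open>
  The pair \<open>(X, [f\<^sub>1, \<dots>, f\<^sub>n])\<close> is the path that starts at \<open>X\<close> and runs through
  \<open>f\<^sub>1, \<dots>, f\<^sub>n\<close> in this order; the starting object is needed for \<open>n = 0\<close>.
\<close>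

type_synonym ('o, 'a) path = "'o \<times> 'a list"

definition path_obj :: "('o, 'a, 'c, 'z) bicat_scheme \<Rightarrow> ('o, 'a) path \<Rightarrow> nat \<Rightarrow> 'o"
  where "path_obj B P i = (if i = 0 then fst P else trg B (snd P ! (i - 1)))"

definition path_length :: "('o, 'a) path \<Rightarrow> nat"
  where "path_length P = length (snd P)"

definition paths :: "('o, 'a, 'c, 'z) bicat_scheme \<Rightarrow> ('o, 'a) path set"
  where "paths B = {P. fst P \<in> Obj B \<and> set (snd P) \<subseteq> Arr B \<and>
    (\<forall>i < path_length P. src B (snd P ! i) = path_obj B P i)}"

definition path_append :: "('o, 'a) path \<Rightarrow> ('o, 'a) path \<Rightarrow> ('o, 'a) path"
  where "path_append P Q = (fst P, snd P @ snd Q)"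

text \<open>\<open>segment B P i j\<close> consists of the arrows \<open>f\<^sub>i\<^sub>+\<^sub>1, \<dots>, f\<^sub>j\<close> of \<open>P\<close>, for \<open>i \<le> j\<close>.\<close>

definition segment ::
    "('o, 'a, 'c, 'z) bicat_scheme \<Rightarrow> ('o, 'a) path \<Rightarrow> nat \<Rightarrow> nat \<Rightarrow> ('o, 'a) path"
  where "segment B P i j = (path_obj B P i, take (j - i) (drop i (snd P)))"

text \<open>
  Formal composites. \<open>Then s t\<close> is \<open>s\<close> followed by \<open>t\<close>, so that its value is the composite
  of the value of \<open>t\<close> after the value of \<open>s\<close>.
\<close>

datatype ('o, 'a) bracketing =
    Unit 'o
  | Single 'a
  | Then "('o, 'a) bracketing" "('o, 'a) bracketing"

primrec leaves :: "('o, 'a) bracketing \<Rightarrow> 'a list" where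
  "leaves (Unit X) = []"
| "leaves (Single f) = [f]"
| "leaves (Then s t) = leaves s @ leaves t"

primrec unit_free :: "('o, 'a) bracketing \<Rightarrow> bool" where
  "unit_free (Unit X) \<longleftrightarrow> False"
| "unit_free (Single f) \<longleftrightarrow> True"
| "unit_free (Then s t) \<longleftrightarrow> unit_free s \<and> unit_free t"

primrec val :: "('o, 'a, 'c, 'z) bicat_scheme \<Rightarrow> ('o, 'a) bracketing \<Rightarrow> 'a" where
  "val B (Unit X) = \<one>\<^bsub>B\<^esub> X"
| "val B (Single f) = f"
| "val B (Then s t) = val B t \<odot>\<^bsub>B\<^esub> val B s"

primrec formal :: "('o, 'a, 'c, 'z) bicat_scheme \<Rightarrow> ('o, 'a) bracketing \<Rightarrow> bool" where
  "formal B (Unit X) \<longleftrightarrow> X \<in> Obj B"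
| "formal B (Single f) \<longleftrightarrow> f \<in> Arr B"
| "formal B (Then s t) \<longleftrightarrow> formal B s \<and> formal B t \<and> trg B (val B s) = src B (val B t)"

text \<open>
  A choice of composites: the empty path at \<open>X\<close> is sent to the identity of \<open>X\<close>, and a
  nonempty path to one of its bracketings, without inserted identities. In particular the
  path consisting of a single arrow \<open>f\<close> is sent to \<open>f\<close>.
\<close>

definition composite_choice ::
    "('o, 'a, 'c, 'z) bicat_scheme \<Rightarrow> (('o, 'a) path \<Rightarrow> ('o, 'a) bracketing) \<Rightarrow> bool"
  where "composite_choice B \<phi> \<longleftrightarrow>
    (\<forall>P \<in> paths B. if snd P = [] then \<phi> P = Unit (fst P)
                   else unit_free (\<phi> P) \<and> leaves (\<phi> P) = snd P)"

text \<open>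
  \<open>canonical B s t \<alpha>\<close> means that \<open>\<alpha>\<close>, a cell from the value of \<open>s\<close> to the value of \<open>t\<close>, is
  built from the associativity and unit cells of \<open>B\<close>. The relation refers to formal
  composites because distinct formal composites may have the same value. By the coherence
  theorem \<open>\<alpha>\<close> is determined by \<open>s\<close> and \<open>t\<close>.
\<close>

inductive canonical ::
    "('o, 'a, 'c, 'z) bicat_scheme \<Rightarrow> ('o, 'a) bracketing \<Rightarrow> ('o, 'a) bracketing \<Rightarrow> 'c \<Rightarrow> bool"
  for B where
  canonical_cid: "formal B t \<Longrightarrow> canonical B t t (\<iota>\<^bsub>B\<^esub> (val B t))"
| canonical_assoc: "formal B (Then (Then r s) t) \<Longrightarrow> formal B (Then r (Then s t)) \<Longrightarrow>
    canonical B (Then r (Then s t)) (Then (Then r s) t)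
      (\<a>\<^bsub>B\<^esub> (val B t) (val B s) (val B r))"
| canonical_lunit: "formal B t \<Longrightarrow>
    canonical B (Then t (Unit (trg B (val B t)))) t (\<l>\<^bsub>B\<^esub> (val B t))"
| canonical_runit: "formal B t \<Longrightarrow>
    canonical B (Then (Unit (src B (val B t))) t) t (\<r>\<^bsub>B\<^esub> (val B t))"
| canonical_inverse: "canonical B s t \<alpha> \<Longrightarrow> inverse_cells B \<alpha> \<beta> \<Longrightarrow> canonical B t s \<beta>"
| canonical_vcomp: "canonical B r s \<alpha> \<Longrightarrow> canonical B s t \<beta> \<Longrightarrow>
    canonical B r t (\<beta> \<cdot>\<^bsub>B\<^esub> \<alpha>)"
| canonical_hcomp: "canonical B s s' \<alpha> \<Longrightarrow> canonical B t t' \<beta> \<Longrightarrow> formal B (Then s t) \<Longrightarrow>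
    canonical B (Then s t) (Then s' t') (\<beta> \<star>\<^bsub>B\<^esub> \<alpha>)"

definition comparison ::
    "('o, 'a, 'c, 'z) bicat_scheme \<Rightarrow> (('o, 'a) path \<Rightarrow> ('o, 'a) bracketing) \<Rightarrow>
      ('o, 'a) path \<Rightarrow> ('o, 'a) path \<Rightarrow> 'c"
  where "comparison B \<phi> P Q = (THE \<alpha>. canonical B (Then (\<phi> P) (\<phi> Q)) (\<phi> (path_append P Q)) \<alpha>)"


section \<open>The double category of marked paths\<close>

type_synonym ('o, 'a) marked = "('o, 'a) path \<times> nat"
type_synonym ('o, 'a) marked2 = "('o, 'a) path \<times> nat \<times> nat"

fun marked_obj :: "('o, 'a, 'c, 'z) bicat_scheme \<Rightarrow> ('o, 'a) marked \<Rightarrow> 'o"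
  where "marked_obj B (P, i) = path_obj B P i"

fun marked_dom :: "('o, 'a) marked2 \<Rightarrow> ('o, 'a) marked"
  where "marked_dom (P, i, j) = (P, i)"

fun marked_cod :: "('o, 'a) marked2 \<Rightarrow> ('o, 'a) marked"
  where "marked_cod (P, i, j) = (P, j)"

fun marked_segment :: "('o, 'a, 'c, 'z) bicat_scheme \<Rightarrow> ('o, 'a) marked2 \<Rightarrow> ('o, 'a) path"
  where "marked_segment B (P, i, j) = segment B P i j"

definition chosen_composite ::
    "('o, 'a, 'c, 'z) bicat_scheme \<Rightarrow> (('o, 'a) path \<Rightarrow> ('o, 'a) bracketing) \<Rightarrow>
      ('o, 'a) marked2 \<Rightarrow> 'a"
  where "chosen_composite B \<phi> h = val B (\<phi> (marked_segment B h))"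

definition marked_comparison ::
    "('o, 'a, 'c, 'z) bicat_scheme \<Rightarrow> (('o, 'a) path \<Rightarrow> ('o, 'a) bracketing) \<Rightarrow>
      ('o, 'a) marked2 \<Rightarrow> ('o, 'a) marked2 \<Rightarrow> 'c"
  where "marked_comparison B \<phi> h k = comparison B \<phi> (marked_segment B h) (marked_segment B k)"

text \<open>
  A vertical arrow is the pair of its domain and codomain. A square is a triple consisting of
  its top, its bottom and a 2-cell of \<open>B\<close>; its sides are determined by the top and bottom.
\<close>

definition Dbl ::
    "('o, 'a, 'c, 'z) bicat_scheme \<Rightarrow> (('o, 'a) path \<Rightarrow> ('o, 'a) bracketing) \<Rightarrow>
      (('o, 'a) marked, ('o, 'a) marked2, ('o, 'a) marked \<times> ('o, 'a) marked,
       ('o, 'a) marked2 \<times> ('o, 'a) marked2 \<times> 'c) dblcat"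
  where "Dbl B \<phi> =
    (let O' = {(P, i). P \<in> paths B \<and> i \<le> path_length P};
         H = {(P, i, j). P \<in> paths B \<and> i \<le> j \<and> j \<le> path_length P}
     in
     \<lparr>dobj = O',
      harr = H,
      hdom = marked_dom,
      hcod = marked_cod,
      harr_id = (\<lambda>(P, i). (P, i, i)),
      harr_comp = (\<lambda>(P', i', j') (P, i, j). (P, i, j')),
      varr = {(x, y). x \<in> O' \<and> y \<in> O' \<and> marked_obj B x = marked_obj B y},
      vdom = fst,
      vcod = snd,
      varr_id = (\<lambda>x. (x, x)),
      varr_comp = (\<lambda>w v. (fst v, snd w)),
      squares = {(h, k, \<alpha>). h \<in> H \<and> k \<in> H \<and>
        marked_obj B (marked_dom h) = marked_obj B (marked_dom k) \<and>
        marked_obj B (marked_cod h) = marked_obj B (marked_cod k) \<and>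
        \<alpha> \<in> cells B (chosen_composite B \<phi> h) (chosen_composite B \<phi> k)},
      sq_top = (\<lambda>(h, k, \<alpha>). h),
      sq_bottom = (\<lambda>(h, k, \<alpha>). k),
      sq_left = (\<lambda>(h, k, \<alpha>). (marked_dom h, marked_dom k)),
      sq_right = (\<lambda>(h, k, \<alpha>). (marked_cod h, marked_cod k)),
      sq_vid = (\<lambda>h. (h, h, \<iota>\<^bsub>B\<^esub> (chosen_composite B \<phi> h))),
      sq_hid = (\<lambda>((P, i), (Q, j)). ((P, i, i), (Q, j, j), \<iota>\<^bsub>B\<^esub> (\<one>\<^bsub>B\<^esub> (path_obj B P i)))),
      sq_vcomp = (\<lambda>(h', k', \<beta>) (h, k, \<alpha>). (h, k', \<beta> \<cdot>\<^bsub>B\<^esub> \<alpha>)),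
      sq_hcomp = (\<lambda>((P', i', j'), (Q', m', n'), \<beta>) ((P, i, j), (Q, m, n), \<alpha>).
        ((P, i, j'), (Q, m, n'),
         marked_comparison B \<phi> (Q, m, n) (Q', m', n') \<cdot>\<^bsub>B\<^esub>
           ((\<beta> \<star>\<^bsub>B\<^esub> \<alpha>) \<cdot>\<^bsub>B\<^esub>
             cell_inv B (marked_comparison B \<phi> (P, i, j) (P', i', j')))))\<rparr>)"

end

(* The comparison cells of Dbl B are only characterised as canonical cells, so they can be computed
   with only once coherence is known. Coherence follows from reassociation cells
   t n => f_k (... (f_1 n)), where f_1, ..., f_k are the leaves of the bracketing t: by induction on
   its derivation, a canonical cell s => t whiskered with n commutes with the reassociations of s
   and t, hence is determined by s and t.

   The comparisons entering the companion equations are then the unit cells, and a marked path is a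
   companion exactly if its marked objects agree and its composite is isomorphic to an identity.
   So f is a left (right) pre-companion iff its composite F has a left (right) inverse up to
   isomorphism; conversely an inverse g is realised by the paths [F, g] and [g, F]. An arrow with
   inverses on both sides is an equivalence. *)

theory Submission
  imports Defs
begin

section \<open>Boundaries of arrows and 2-cells, and the axioms in rewriting form\<close>

context bicategory
begin

text \<open>The axioms speak of hom sets and sets of parallel cells. Here and in the next lemmas
  they are restated through \<open>src\<close>, \<open>trg\<close>, \<open>cdom\<close> and
  \<open>ccod\<close>, so that simplification can check that a pasting of cells is well
  formed.\<close>

lemma comp_arr [simp]:
  assumes "f \<in> Arr B" "g \<in> Arr B" "trg B f = src B g"
  shows "g \<odot> f \<in> Arr B" "src B (g \<odot> f) = src B f" "trg B (g \<odot> f) = trg B g"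
  using comp_hom[of f "src B f" "trg B f" g "trg B g"] assms by (auto simp: hom_def)

lemma one_arr [simp]:
  assumes "X \<in> Obj B"
  shows "\<one> X \<in> Arr B" "src B (\<one> X) = X" "trg B (\<one> X) = X"
  using one_hom[OF assms] by (auto simp: hom_def)

lemma arr_obj [simp]:
  assumes "f \<in> Arr B"
  shows "src B f \<in> Obj B" "trg B f \<in> Obj B"
  using arr_bounds[OF assms] by auto

lemma cell_arr [simp]:
  assumes "\<alpha> \<in> Cell B"
  shows "cdom B \<alpha> \<in> Arr B" "ccod B \<alpha> \<in> Arr B"
    "src B (ccod B \<alpha>) = src B (cdom B \<alpha>)" "trg B (ccod B \<alpha>) = trg B (cdom B \<alpha>)"
  using cell_bounds[OF assms] by auto

lemma cid_bounds [simp]: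
  assumes "f \<in> Arr B"
  shows "\<iota> f \<in> Cell B" "cdom B (\<iota> f) = f" "ccod B (\<iota> f) = f"
  using cid_cell[OF assms] by (auto simp: cells_def)

lemma vcomp_bounds [simp]:
  assumes "\<alpha> \<in> Cell B" "\<beta> \<in> Cell B" "ccod B \<alpha> = cdom B \<beta>"
  shows "\<beta> \<cdot> \<alpha> \<in> Cell B" "cdom B (\<beta> \<cdot> \<alpha>) = cdom B \<alpha>" "ccod B (\<beta> \<cdot> \<alpha>) = ccod B \<beta>"
  using vcomp_cell[of \<alpha> "cdom B \<alpha>" "cdom B \<beta>" \<beta> "ccod B \<beta>"] assms by (auto simp: cells_def)

lemma hcomp_bounds [simp]:
  assumes "\<alpha> \<in> Cell B" "\<beta> \<in> Cell B" "trg B (cdom B \<alpha>) = src B (cdom B \<beta>)"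
  shows "\<beta> \<star> \<alpha> \<in> Cell B" "cdom B (\<beta> \<star> \<alpha>) = cdom B \<beta> \<odot> cdom B \<alpha>"
    "ccod B (\<beta> \<star> \<alpha>) = ccod B \<beta> \<odot> ccod B \<alpha>"
  using hcomp_cell[of \<alpha> "cdom B \<alpha>" "ccod B \<alpha>" \<beta> "cdom B \<beta>" "ccod B \<beta>"] assms
  by (auto simp: cells_def)

lemma vcomp_cid [simp]:
  assumes "\<alpha> \<in> Cell B"
  shows "ccod B \<alpha> = f \<Longrightarrow> \<iota> f \<cdot> \<alpha> = \<alpha>" "cdom B \<alpha> = f \<Longrightarrow> \<alpha> \<cdot> \<iota> f = \<alpha>"
  using assms vcomp_cid_left vcomp_cid_right by (auto simp: cells_def)

text \<open>As a simp rule this nests vertical composites to the right. Later calculations regroup a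
  pasting by reducing both groupings to this normal form.\<close>

lemma vcomp_assoc' [simp]:
  assumes "\<alpha> \<in> Cell B" "\<beta> \<in> Cell B" "\<gamma> \<in> Cell B" "ccod B \<alpha> = cdom B \<beta>" "ccod B \<beta> = cdom B \<gamma>"
  shows "(\<gamma> \<cdot> \<beta>) \<cdot> \<alpha> = \<gamma> \<cdot> (\<beta> \<cdot> \<alpha>)"
  by (rule vcomp_assoc) (use assms in \<open>auto simp: cells_def\<close>)

lemma hcomp_cid' [simp]:
  assumes "f \<in> Arr B" "g \<in> Arr B" "trg B f = src B g"
  shows "\<iota> g \<star> \<iota> f = \<iota> (g \<odot> f)"
  using hcomp_cid assms by (auto simp: hom_def)

text \<open>Oriented to merge two layers of horizontal composites into one; it is applied by name
  where layers are to be merged or split.\<close>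

lemma interchange':
  assumes "\<alpha> \<in> Cell B" "\<alpha>' \<in> Cell B" "\<beta> \<in> Cell B" "\<beta>' \<in> Cell B"
    "ccod B \<alpha> = cdom B \<alpha>'" "ccod B \<beta> = cdom B \<beta>'" "trg B (cdom B \<alpha>) = src B (cdom B \<beta>)"
  shows "(\<beta>' \<star> \<alpha>') \<cdot> (\<beta> \<star> \<alpha>) = (\<beta>' \<cdot> \<beta>) \<star> (\<alpha>' \<cdot> \<alpha>)"
  by (rule interchange[symmetric]) (use assms in \<open>auto simp: cells_def\<close>)

lemma iso_cells_iff:
  "\<alpha> \<in> iso_cells B f g \<longleftrightarrow> \<alpha> \<in> Cell B \<and> cdom B \<alpha> = f \<and> ccod B \<alpha> = g \<and>
    (\<exists>\<beta> \<in> Cell B. cdom B \<beta> = g \<and> ccod B \<beta> = f \<and> \<beta> \<cdot> \<alpha> = \<iota> f \<and> \<alpha> \<cdot> \<beta> = \<iota> g)"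
  by (auto simp: iso_cells_def inverse_cells_def cells_def)

lemma iso_cells_cell:
  "\<alpha> \<in> iso_cells B f g \<Longrightarrow> \<alpha> \<in> Cell B" "\<alpha> \<in> iso_cells B f g \<Longrightarrow> cdom B \<alpha> = f"
  "\<alpha> \<in> iso_cells B f g \<Longrightarrow> ccod B \<alpha> = g"
  by (auto simp: iso_cells_iff)

lemma assoc_iso [simp]:
  assumes "f \<in> Arr B" "g \<in> Arr B" "h \<in> Arr B" "trg B f = src B g" "trg B g = src B h"
  shows "\<a> h g f \<in> iso_cells B ((h \<odot> g) \<odot> f) (h \<odot> (g \<odot> f))"
  using assoc_cell assms by (auto simp: hom_def)

lemma unit_iso [simp]:
  assumes "f \<in> Arr B"
  shows "trg B f = Y \<Longrightarrow> \<l> f \<in> iso_cells B (\<one> Y \<odot> f) f"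
    and "src B f = X \<Longrightarrow> \<r> f \<in> iso_cells B (f \<odot> \<one> X) f"
  using lunit_cell runit_cell assms by (auto simp: hom_def)

lemma assoc_bounds [simp]:
  assumes "f \<in> Arr B" "g \<in> Arr B" "h \<in> Arr B" "trg B f = src B g" "trg B g = src B h"
  shows "\<a> h g f \<in> Cell B" "cdom B (\<a> h g f) = (h \<odot> g) \<odot> f" "ccod B (\<a> h g f) = h \<odot> (g \<odot> f)"
  using iso_cells_cell[OF assoc_iso[OF assms]] by auto

lemma unit_bounds [simp]:
  assumes "f \<in> Arr B"
  shows "\<l> f \<in> Cell B" "cdom B (\<l> f) = \<one> (trg B f) \<odot> f" "ccod B (\<l> f) = f"
    and "\<r> f \<in> Cell B" "cdom B (\<r> f) = f \<odot> \<one> (src B f)" "ccod B (\<r> f) = f"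
  using iso_cells_cell[OF unit_iso(1)[OF assms refl]] iso_cells_cell[OF unit_iso(2)[OF assms refl]]
  by auto

lemma assoc_natural':
  assumes "\<alpha> \<in> Cell B" "\<beta> \<in> Cell B" "\<gamma> \<in> Cell B"
    "trg B (cdom B \<alpha>) = src B (cdom B \<beta>)" "trg B (cdom B \<beta>) = src B (cdom B \<gamma>)"
  shows "\<a> (ccod B \<gamma>) (ccod B \<beta>) (ccod B \<alpha>) \<cdot> ((\<gamma> \<star> \<beta>) \<star> \<alpha>) =
    (\<gamma> \<star> (\<beta> \<star> \<alpha>)) \<cdot> \<a> (cdom B \<gamma>) (cdom B \<beta>) (cdom B \<alpha>)"
  by (rule assoc_natural) (use assms in \<open>auto simp: cells_def\<close>)

lemma lunit_natural':
  assumes "\<alpha> \<in> Cell B"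
  shows "\<l> (ccod B \<alpha>) \<cdot> (\<iota> (\<one> (trg B (cdom B \<alpha>))) \<star> \<alpha>) = \<alpha> \<cdot> \<l> (cdom B \<alpha>)"
  by (rule lunit_natural) (use assms in \<open>auto simp: cells_def\<close>)

lemma runit_natural':
  assumes "\<alpha> \<in> Cell B"
  shows "\<r> (ccod B \<alpha>) \<cdot> (\<alpha> \<star> \<iota> (\<one> (src B (cdom B \<alpha>)))) = \<alpha> \<cdot> \<r> (cdom B \<alpha>)"
  by (rule runit_natural) (use assms in \<open>auto simp: cells_def\<close>)

section \<open>Invertible 2-cells and cancellation\<close>

lemma iso_cid [simp]: "f \<in> Arr B \<Longrightarrow> \<iota> f \<in> iso_cells B f f"
  by (auto simp: iso_cells_iff intro!: bexI[of _ "\<iota> f"])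

lemma iso_inverse:
  assumes "\<alpha> \<in> iso_cells B f g"
  obtains \<beta> where "\<beta> \<in> iso_cells B g f" "\<beta> \<cdot> \<alpha> = \<iota> f" "\<alpha> \<cdot> \<beta> = \<iota> g"
  using assms by (auto simp: iso_cells_iff)

lemma iso_vcomp:
  assumes "\<alpha> \<in> iso_cells B f g" "\<beta> \<in> iso_cells B g h"
  shows "\<beta> \<cdot> \<alpha> \<in> iso_cells B f h"
proof -
  obtain \<alpha>' where a: "\<alpha>' \<in> iso_cells B g f" "\<alpha>' \<cdot> \<alpha> = \<iota> f" "\<alpha> \<cdot> \<alpha>' = \<iota> g"
    using assms(1) by (rule iso_inverse)
  obtain \<beta>' where b: "\<beta>' \<in> iso_cells B h g" "\<beta>' \<cdot> \<beta> = \<iota> g" "\<beta> \<cdot> \<beta>' = \<iota> h"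
    using assms(2) by (rule iso_inverse)
  note [simp] = iso_cells_cell[OF assms(1)] iso_cells_cell[OF assms(2)]
    iso_cells_cell[OF a(1)] iso_cells_cell[OF b(1)]
  have "(\<alpha>' \<cdot> \<beta>') \<cdot> (\<beta> \<cdot> \<alpha>) = \<alpha>' \<cdot> (\<beta>' \<cdot> \<beta>) \<cdot> \<alpha>" by simp
  then have 1: "(\<alpha>' \<cdot> \<beta>') \<cdot> (\<beta> \<cdot> \<alpha>) = \<iota> f" unfolding a b by (simp add: a)
  have "(\<beta> \<cdot> \<alpha>) \<cdot> (\<alpha>' \<cdot> \<beta>') = \<beta> \<cdot> (\<alpha> \<cdot> \<alpha>') \<cdot> \<beta>'" by simp
  then have 2: "(\<beta> \<cdot> \<alpha>) \<cdot> (\<alpha>' \<cdot> \<beta>') = \<iota> h" unfolding a b by (simp add: b)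
  show ?thesis
    unfolding iso_cells_iff by (intro conjI bexI[of _ "\<alpha>' \<cdot> \<beta>'"] 1 2) simp_all
qed

lemma iso_hcomp:
  assumes "\<alpha> \<in> iso_cells B f f'" "\<beta> \<in> iso_cells B g g'" "trg B f = src B g"
  shows "\<beta> \<star> \<alpha> \<in> iso_cells B (g \<odot> f) (g' \<odot> f')"
proof -
  obtain \<alpha>' where a: "\<alpha>' \<in> iso_cells B f' f" "\<alpha>' \<cdot> \<alpha> = \<iota> f" "\<alpha> \<cdot> \<alpha>' = \<iota> f'"
    using assms(1) by (rule iso_inverse)
  obtain \<beta>' where b: "\<beta>' \<in> iso_cells B g' g" "\<beta>' \<cdot> \<beta> = \<iota> g" "\<beta> \<cdot> \<beta>' = \<iota> g'"
    using assms(2) by (rule iso_inverse)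
  note [simp] = iso_cells_cell[OF assms(1)] iso_cells_cell[OF assms(2)]
    iso_cells_cell[OF a(1)] iso_cells_cell[OF b(1)] assms(3)
  have c: "trg B f' = src B g'" "f \<in> Arr B" "f' \<in> Arr B" "g \<in> Arr B" "g' \<in> Arr B"
    using assms(3) cell_arr[of \<alpha>] cell_arr[of \<beta>] by simp_all
  show ?thesis
    unfolding iso_cells_iff
    by (intro conjI bexI[of _ "\<beta>' \<star> \<alpha>'"]) (simp_all add: c a b interchange')
qed

lemma iso_cancel_left:
  assumes "\<gamma> \<in> iso_cells B g h" "\<gamma> \<cdot> \<alpha> = \<gamma> \<cdot> \<beta>"
    "\<alpha> \<in> Cell B" "\<beta> \<in> Cell B" "ccod B \<alpha> = g" "ccod B \<beta> = g"
  shows "\<alpha> = \<beta>"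
proof -
  obtain \<gamma>' where c: "\<gamma>' \<in> iso_cells B h g" "\<gamma>' \<cdot> \<gamma> = \<iota> g"
    using assms(1) by (rule iso_inverse)
  note [simp] = iso_cells_cell[OF assms(1)] iso_cells_cell[OF c(1)] assms(3-)
  have "(\<gamma>' \<cdot> \<gamma>) \<cdot> \<alpha> = (\<gamma>' \<cdot> \<gamma>) \<cdot> \<beta>" using assms(2) by simp
  then show ?thesis by (simp only: c) simp
qed

lemma iso_cancel_right:
  assumes "\<gamma> \<in> iso_cells B g h" "\<alpha> \<cdot> \<gamma> = \<beta> \<cdot> \<gamma>"
    "\<alpha> \<in> Cell B" "\<beta> \<in> Cell B" "cdom B \<alpha> = h" "cdom B \<beta> = h"
  shows "\<alpha> = \<beta>"
proof -
  obtain \<gamma>' where c: "\<gamma>' \<in> iso_cells B h g" "\<gamma> \<cdot> \<gamma>' = \<iota> h"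
    using assms(1) by (rule iso_inverse)
  note [simp] = iso_cells_cell[OF assms(1)] iso_cells_cell[OF c(1)] assms(3-)
  have "\<alpha> \<cdot> \<gamma> \<cdot> \<gamma>' = \<beta> \<cdot> \<gamma> \<cdot> \<gamma>'"
    using assms(2) vcomp_assoc'[of \<gamma>' \<gamma> \<alpha>] vcomp_assoc'[of \<gamma>' \<gamma> \<beta>] by simp
  then show ?thesis by (simp add: c)
qed

section \<open>Whiskering with identity arrows, and the unit law for composites\<close>

lemma hcomp_one_left_cancel:
  assumes "\<iota> (\<one> Y) \<star> \<alpha> = \<iota> (\<one> Y) \<star> \<beta>" "\<alpha> \<in> cells B f g" "\<beta> \<in> cells B f g" "trg B f = Y"
  shows "\<alpha> = \<beta>"
proof -
  have t [simp]: "\<alpha> \<in> Cell B" "cdom B \<alpha> = f" "ccod B \<alpha> = g" "\<beta> \<in> Cell B" "cdom B \<beta> = f" "ccod B \<beta> = g"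
    using assms by (auto simp: cells_def)
  have f: "f \<in> Arr B" using cell_arr[of \<alpha>] by simp
  \<comment> \<open>Naturality of \<open>\<l>\<close> expresses \<alpha> and \<beta>, each composed
    with the invertible \<open>\<l> f\<close>, through their whiskerings, which agree by
    assumption.\<close>
  have "\<alpha> \<cdot> \<l> f = \<beta> \<cdot> \<l> f"
    using lunit_natural'[of \<alpha>] lunit_natural'[of \<beta>] assms by simp
  from iso_cancel_right[OF unit_iso(1)[OF f refl] this] show ?thesis by simp
qed

lemma hcomp_one_right_cancel:
  assumes "\<alpha> \<star> \<iota> (\<one> X) = \<beta> \<star> \<iota> (\<one> X)" "\<alpha> \<in> cells B f g" "\<beta> \<in> cells B f g" "src B f = X"
  shows "\<alpha> = \<beta>"
proof -
  have t [simp]: "\<alpha> \<in> Cell B" "cdom B \<alpha> = f" "ccod B \<alpha> = g" "\<beta> \<in> Cell B" "cdom B \<beta> = f" "ccod B \<beta> = g"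
    using assms by (auto simp: cells_def)
  have f: "f \<in> Arr B" using cell_arr[of \<alpha>] by simp
  have "\<alpha> \<cdot> \<r> f = \<beta> \<cdot> \<r> f"
    using runit_natural'[of \<alpha>] runit_natural'[of \<beta>] assms by simp
  from iso_cancel_right[OF unit_iso(2)[OF f refl] this] show ?thesis by simp
qed

text \<open>Kelly's argument: the identity is checked after composing with an identity arrow on the left.\<close>

lemma lunit_comp:
  assumes [simp]: "f \<in> Arr B" "g \<in> Arr B" "trg B f = src B g"
  shows "\<l> (g \<odot> f) \<cdot> \<a> (\<one> (trg B g)) g f = \<l> g \<star> \<iota> f"
proof (rule hcomp_one_left_cancel[where f = "(\<one> (trg B g) \<odot> g) \<odot> f" and g = "g \<odot> f"])
  let ?i = "\<one> (trg B g)"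
  \<comment> \<open>\<open>?k\<close> consists of the first two edges on the longer side of the
    pentagon for f, g and two identities. It is invertible and is cancelled at the end.\<close>
  let ?k = "\<a> ?i (?i \<odot> g) f \<cdot> (\<a> ?i ?i g \<star> \<iota> f)"
  have "(\<iota> ?i \<star> (\<l> (g \<odot> f) \<cdot> \<a> ?i g f)) \<cdot> ?k =
      ((\<iota> ?i \<star> \<l> (g \<odot> f)) \<cdot> (\<iota> ?i \<star> \<a> ?i g f)) \<cdot> ?k"
    by (simp add: interchange')
  also have "\<dots> = (\<iota> ?i \<star> \<l> (g \<odot> f)) \<cdot> (\<iota> ?i \<star> \<a> ?i g f) \<cdot> ?k"
    by simp
  also have "(\<iota> ?i \<star> \<a> ?i g f) \<cdot> ?k = \<a> ?i ?i (g \<odot> f) \<cdot> \<a> (?i \<odot> ?i) g f"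
    by (rule pentagon) (auto simp: hom_def)
  also have "(\<iota> ?i \<star> \<l> (g \<odot> f)) \<cdot> \<a> ?i ?i (g \<odot> f) \<cdot> \<a> (?i \<odot> ?i) g f =
      ((\<iota> ?i \<star> \<l> (g \<odot> f)) \<cdot> \<a> ?i ?i (g \<odot> f)) \<cdot> \<a> (?i \<odot> ?i) g f"
    by simp
  \<comment> \<open>The triangle replaces the left unit cell of \<open>g \<odot> f\<close> by
    \<open>\<r> ?i\<close>. After naturality of associativity the triangle is used backwards to turn
    \<open>\<r> ?i\<close> into the left unit cell of g.\<close>
  also have "(\<iota> ?i \<star> \<l> (g \<odot> f)) \<cdot> \<a> ?i ?i (g \<odot> f) = \<r> ?i \<star> \<iota> g \<star> \<iota> f"
    by (subst triangle) (auto simp: hom_def)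
  also have "(\<r> ?i \<star> \<iota> g \<star> \<iota> f) \<cdot> \<a> (?i \<odot> ?i) g f = \<a> ?i g f \<cdot> ((\<r> ?i \<star> \<iota> g) \<star> \<iota> f)"
    using assoc_natural'[of "\<iota> f" "\<iota> g" "\<r> ?i"] by simp
  also have "\<r> ?i \<star> \<iota> g = (\<iota> ?i \<star> \<l> g) \<cdot> \<a> ?i ?i g"
    by (subst triangle) (auto simp: hom_def)
  also have "\<dots> \<star> \<iota> f = ((\<iota> ?i \<star> \<l> g) \<star> \<iota> f) \<cdot> (\<a> ?i ?i g \<star> \<iota> f)"
    by (simp add: interchange')
  also have "\<a> ?i g f \<cdot> \<dots> = (\<a> ?i g f \<cdot> ((\<iota> ?i \<star> \<l> g) \<star> \<iota> f)) \<cdot> (\<a> ?i ?i g \<star> \<iota> f)"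
    by simp
  also have "\<a> ?i g f \<cdot> ((\<iota> ?i \<star> \<l> g) \<star> \<iota> f) = (\<iota> ?i \<star> (\<l> g \<star> \<iota> f)) \<cdot> \<a> ?i (?i \<odot> g) f"
    using assoc_natural'[of "\<iota> f" "\<l> g" "\<iota> ?i"] by simp
  also have "\<dots> \<cdot> (\<a> ?i ?i g \<star> \<iota> f) = (\<iota> ?i \<star> (\<l> g \<star> \<iota> f)) \<cdot> ?k"
    by simp
  finally have e: "(\<iota> ?i \<star> (\<l> (g \<odot> f) \<cdot> \<a> ?i g f)) \<cdot> ?k = (\<iota> ?i \<star> (\<l> g \<star> \<iota> f)) \<cdot> ?k" .
  have k: "?k \<in> iso_cells B (((?i \<odot> ?i) \<odot> g) \<odot> f) (?i \<odot> ((?i \<odot> g) \<odot> f))"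
    by (rule iso_vcomp[OF iso_hcomp[OF iso_cid assoc_iso] assoc_iso]) simp_all
  show "\<iota> ?i \<star> (\<l> (g \<odot> f) \<cdot> \<a> ?i g f) = \<iota> ?i \<star> (\<l> g \<star> \<iota> f)"
    by (rule iso_cancel_right[OF k e]) simp_all
qed (auto simp: cells_def)

end

subsection \<open>Coherence\<close>

text \<open>The arrow n is an accumulator: s is flattened onto n first, and t onto the result. It
  turns every unit into a left unit, absorbed by \<open>\<l>\<close>, and makes the target of the
  cell depend on t only through \<open>leaves t\<close>.\<close>

primrec reassoc :: "('o, 'a, 'c, 'z) bicat_scheme \<Rightarrow> ('o, 'a) bracketing \<Rightarrow> 'a \<Rightarrow> 'c" where
  "reassoc B (Unit X) n = \<l>\<^bsub>B\<^esub> n"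
| "reassoc B (Single f) n = \<iota>\<^bsub>B\<^esub> (f \<odot>\<^bsub>B\<^esub> n)"
| "reassoc B (Then s t) n = reassoc B t (fold (comp B) (leaves s) n) \<cdot>\<^bsub>B\<^esub>
    ((\<iota>\<^bsub>B\<^esub> (val B t) \<star>\<^bsub>B\<^esub> reassoc B s n) \<cdot>\<^bsub>B\<^esub> \<a>\<^bsub>B\<^esub> (val B t) (val B s) n)"

context bicategory
begin

lemma val_arr [simp]: "formal B t \<Longrightarrow> val B t \<in> Arr B"
  by (induction t) auto

lemma fold_leaves:
  assumes "formal B t" "n \<in> Arr B" "trg B n = src B (val B t)"
  shows "fold (comp B) (leaves t) n \<in> Arr B"
    and "src B (fold (comp B) (leaves t) n) = src B n"
    and "trg B (fold (comp B) (leaves t) n) = trg B (val B t)"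
  using assms by (induction t arbitrary: n) auto

lemma reassoc_iso:
  assumes "formal B t" "n \<in> Arr B" "trg B n = src B (val B t)"
  shows "reassoc B t n \<in> iso_cells B (val B t \<odot> n) (fold (comp B) (leaves t) n)"
  using assms
proof (induction t arbitrary: n)
  case (Then s t)
  then have [simp]: "formal B s" "formal B t" "trg B (val B s) = src B (val B t)"
    "n \<in> Arr B" "trg B n = src B (val B s)" by auto
  let ?N = "fold (comp B) (leaves s) n"
  note [simp] = fold_leaves[of s n]
  have s: "reassoc B s n \<in> iso_cells B (val B s \<odot> n) ?N"
    by (rule Then.IH) auto
  have t: "reassoc B t ?N \<in> iso_cells B (val B t \<odot> ?N) (fold (comp B) (leaves t) ?N)"
    by (rule Then.IH) auto
  show ?case
    using iso_vcomp[OF iso_vcomp[OF assoc_iso iso_hcomp[OF s iso_cid[of "val B t"]]] t] by simp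
qed auto

lemma reassoc_bounds [simp]:
  assumes "formal B t" "n \<in> Arr B" "trg B n = src B (val B t)"
  shows "reassoc B t n \<in> Cell B" "cdom B (reassoc B t n) = val B t \<odot> n"
    "ccod B (reassoc B t n) = fold (comp B) (leaves t) n"
  using iso_cells_cell[OF reassoc_iso[OF assms]] by auto

text \<open>The generators are invertible cells between bracketings with the same leaves, and all
  the closure rules keep this. Equal leaves are what makes the reassociation cells of s and t end in
  the same arrow.\<close>

lemma canonical_iso:
  assumes "canonical B s t \<alpha>"
  shows "formal B s" "formal B t" "leaves s = leaves t" "\<alpha> \<in> iso_cells B (val B s) (val B t)"
proof -
  have "formal B s \<and> formal B t \<and> leaves s = leaves t \<and> \<alpha> \<in> iso_cells B (val B s) (val B t)"
    using assms
  proof induction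
    case (canonical_inverse s t \<alpha> \<beta>)
    then show ?case by (auto simp: iso_cells_iff inverse_cells_def cells_def)
  next
    case (canonical_hcomp s s' \<alpha> t t' \<beta>)
    then have a: "\<alpha> \<in> iso_cells B (val B s) (val B s')" and b: "\<beta> \<in> iso_cells B (val B t) (val B t')"
      by auto
    \<comment> \<open>The rule assumes composability only for s and t; it passes to s' and t'
      because a 2-cell joins parallel arrows.\<close>
    have "trg B (val B s') = src B (val B t')"
      using canonical_hcomp.hyps cell_arr[of \<alpha>] cell_arr[of \<beta>] iso_cells_cell[OF a] iso_cells_cell[OF b]
      by simp
    with canonical_hcomp iso_hcomp[OF a b] show ?case by auto
  next
    case (canonical_vcomp r s \<alpha> t \<beta>)
    then show ?case using iso_vcomp[of \<alpha> "val B r" "val B s" \<beta> "val B t"] by simp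
  next
    case (canonical_assoc r s t)
    from canonical_assoc.hyps(1)
    have "formal B r" "formal B s" "formal B t" "trg B (val B r) = src B (val B s)"
      "trg B (val B s) = src B (val B t)" by auto
    then show ?case by simp
  qed simp_all
  then show "formal B s" "formal B t" "leaves s = leaves t" "\<alpha> \<in> iso_cells B (val B s) (val B t)"
    by auto
qed

lemma canonical_bounds:
  assumes "canonical B s t \<alpha>"
  shows "\<alpha> \<in> Cell B" "cdom B \<alpha> = val B s" "ccod B \<alpha> = val B t"
    "src B (val B t) = src B (val B s)" "trg B (val B t) = trg B (val B s)"
  using iso_cells_cell[OF canonical_iso(4)[OF assms]] cell_arr[of \<alpha>] by auto

section \<open>Canonical cells commute with reassociation\<close>

lemma reassoc_canonical_assoc:
  assumes "formal B (Then (Then r s) t)" and n: "n \<in> Arr B" "trg B n = src B (val B r)"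
  shows "reassoc B (Then (Then r s) t) n \<cdot> (\<a> (val B t) (val B s) (val B r) \<star> \<iota> n) =
    reassoc B (Then r (Then s t)) n"
proof -
  have [simp]: "formal B r" "formal B s" "formal B t" "trg B (val B r) = src B (val B s)"
    "trg B (val B s) = src B (val B t)" using assms by auto
  note [simp] = n
  let ?r = "val B r" and ?s = "val B s" and ?t = "val B t"
  let ?R = "fold (comp B) (leaves r) n"
  let ?S = "fold (comp B) (leaves s) ?R"
  let ?xr = "reassoc B r n" and ?xs = "reassoc B s ?R" and ?xt = "reassoc B t ?S"
  note [simp] = fold_leaves[of r n] fold_leaves[of s ?R]
  have "reassoc B (Then (Then r s) t) n \<cdot> (\<a> ?t ?s ?r \<star> \<iota> n) =
    ?xt \<cdot> ((\<iota> ?t \<star> (?xs \<cdot> ((\<iota> ?s \<star> ?xr) \<cdot> \<a> ?s ?r n))) \<cdot> (\<a> ?t (?s \<odot> ?r) n \<cdot> (\<a> ?t ?s ?r \<star> \<iota> n)))"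
    by simp
  also have "\<iota> ?t \<star> (?xs \<cdot> ((\<iota> ?s \<star> ?xr) \<cdot> \<a> ?s ?r n)) =
    (\<iota> ?t \<star> ?xs) \<cdot> ((\<iota> ?t \<star> (\<iota> ?s \<star> ?xr)) \<cdot> (\<iota> ?t \<star> \<a> ?s ?r n))"
    by (simp add: interchange')
  also have "\<dots> \<cdot> (\<a> ?t (?s \<odot> ?r) n \<cdot> (\<a> ?t ?s ?r \<star> \<iota> n)) =
    (\<iota> ?t \<star> ?xs) \<cdot> ((\<iota> ?t \<star> (\<iota> ?s \<star> ?xr)) \<cdot>
      ((\<iota> ?t \<star> \<a> ?s ?r n) \<cdot> (\<a> ?t (?s \<odot> ?r) n \<cdot> (\<a> ?t ?s ?r \<star> \<iota> n))))"
    by simp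
  \<comment> \<open>All associativity cells now stand together, so that the pentagon applies;
    naturality then moves \<open>?xr\<close> past the remaining one.\<close>
  also have "(\<iota> ?t \<star> \<a> ?s ?r n) \<cdot> (\<a> ?t (?s \<odot> ?r) n \<cdot> (\<a> ?t ?s ?r \<star> \<iota> n)) =
    \<a> ?t ?s (?r \<odot> n) \<cdot> \<a> (?t \<odot> ?s) ?r n"
    by (rule pentagon) (auto simp: hom_def)
  also have "(\<iota> ?t \<star> (\<iota> ?s \<star> ?xr)) \<cdot> (\<a> ?t ?s (?r \<odot> n) \<cdot> \<a> (?t \<odot> ?s) ?r n) =
    ((\<iota> ?t \<star> (\<iota> ?s \<star> ?xr)) \<cdot> \<a> ?t ?s (?r \<odot> n)) \<cdot> \<a> (?t \<odot> ?s) ?r n"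
    by simp
  also have "(\<iota> ?t \<star> (\<iota> ?s \<star> ?xr)) \<cdot> \<a> ?t ?s (?r \<odot> n) = \<a> ?t ?s ?R \<cdot> (\<iota> (?t \<odot> ?s) \<star> ?xr)"
    using assoc_natural'[of ?xr "\<iota> ?s" "\<iota> ?t"] by simp
  also have "?xt \<cdot> ((\<iota> ?t \<star> ?xs) \<cdot> ((\<a> ?t ?s ?R \<cdot> (\<iota> (?t \<odot> ?s) \<star> ?xr)) \<cdot> \<a> (?t \<odot> ?s) ?r n)) =
    reassoc B (Then r (Then s t)) n"
    by simp
  finally show ?thesis .
qed

text \<open>By \<open>lunit_comp\<close> the whiskered unit cell becomes the unit cell of the
  composite with n, which slides past \<open>reassoc B t n\<close> by naturality.\<close>

lemma reassoc_canonical_lunit: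
  assumes [simp]: "formal B t" "n \<in> Arr B" "trg B n = src B (val B t)"
  shows "reassoc B t n \<cdot> (\<l> (val B t) \<star> \<iota> n) = reassoc B (Then t (Unit (trg B (val B t)))) n"
proof -
  note [simp] = fold_leaves[of t n]
  have "reassoc B t n \<cdot> (\<l> (val B t) \<star> \<iota> n) =
    (reassoc B t n \<cdot> \<l> (val B t \<odot> n)) \<cdot> \<a> (\<one> (trg B (val B t))) (val B t) n"
    by (simp add: lunit_comp)
  also have "reassoc B t n \<cdot> \<l> (val B t \<odot> n) =
    \<l> (fold (comp B) (leaves t) n) \<cdot> (\<iota> (\<one> (trg B (val B t))) \<star> reassoc B t n)"
    using lunit_natural'[of "reassoc B t n"] by simp
  finally show ?thesis by simp
qed

text \<open>This is the triangle axiom: the right unit of t is absorbed as a left unit of n.\<close>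

lemma reassoc_canonical_runit:
  assumes [simp]: "formal B t" "n \<in> Arr B" "trg B n = src B (val B t)"
  shows "reassoc B t n \<cdot> (\<r> (val B t) \<star> \<iota> n) = reassoc B (Then (Unit (src B (val B t))) t) n"
proof -
  have "\<r> (val B t) \<star> \<iota> n = (\<iota> (val B t) \<star> \<l> n) \<cdot> \<a> (val B t) (\<one> (src B (val B t))) n"
    by (rule triangle[symmetric]) (auto simp: hom_def)
  then show ?thesis by simp
qed

text \<open>Naturality of associativity brings \<alpha> next to n, where the first hypothesis
  absorbs it. By then s has been flattened onto n, so the hypothesis on \<beta> is needed at that
  longer arrow instead of n.\<close>

lemma reassoc_canonical_hcomp:
  assumes \<alpha>: "canonical B s s' \<alpha>" "reassoc B s' n \<cdot> (\<alpha> \<star> \<iota> n) = reassoc B s n"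
    and \<beta>: "canonical B t t' \<beta>"
      "reassoc B t' (fold (comp B) (leaves s) n) \<cdot> (\<beta> \<star> \<iota> (fold (comp B) (leaves s) n)) =
        reassoc B t (fold (comp B) (leaves s) n)"
    and st: "trg B (val B s) = src B (val B t)"
    and n: "n \<in> Arr B" "trg B n = src B (val B s)"
  shows "reassoc B (Then s' t') n \<cdot> ((\<beta> \<star> \<alpha>) \<star> \<iota> n) = reassoc B (Then s t) n"
proof -
  note [simp] = canonical_iso(1,2)[OF \<alpha>(1)] canonical_iso(1,2)[OF \<beta>(1)] n
    canonical_bounds[OF \<alpha>(1)] canonical_bounds[OF \<beta>(1)] st canonical_iso(3)[OF \<alpha>(1), symmetric]
    canonical_iso(3)[OF \<beta>(1), symmetric]
  let ?N = "fold (comp B) (leaves s) n"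
  note [simp] = fold_leaves[of s n]
  let ?s = "val B s" and ?t = "val B t" and ?s' = "val B s'" and ?t' = "val B t'"
  have c: "ccod B (reassoc B s' n) = ?N"
    by (subst reassoc_bounds) simp_all
  have "reassoc B (Then s' t') n \<cdot> ((\<beta> \<star> \<alpha>) \<star> \<iota> n) =
    reassoc B t' ?N \<cdot> ((\<iota> ?t' \<star> reassoc B s' n) \<cdot> (\<a> ?t' ?s' n \<cdot> ((\<beta> \<star> \<alpha>) \<star> \<iota> n)))"
    using c by simp
  also have "\<a> ?t' ?s' n \<cdot> ((\<beta> \<star> \<alpha>) \<star> \<iota> n) = (\<beta> \<star> (\<alpha> \<star> \<iota> n)) \<cdot> \<a> ?t ?s n"
    using assoc_natural'[of "\<iota> n" \<alpha> \<beta>] by simp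
  also have "(\<iota> ?t' \<star> reassoc B s' n) \<cdot> ((\<beta> \<star> (\<alpha> \<star> \<iota> n)) \<cdot> \<a> ?t ?s n) =
    ((\<iota> ?t' \<star> reassoc B s' n) \<cdot> (\<beta> \<star> (\<alpha> \<star> \<iota> n))) \<cdot> \<a> ?t ?s n"
    by simp
  also have "(\<iota> ?t' \<star> reassoc B s' n) \<cdot> (\<beta> \<star> (\<alpha> \<star> \<iota> n)) =
    (\<beta> \<star> \<iota> ?N) \<cdot> (\<iota> ?t \<star> reassoc B s n)"
    by (simp add: interchange' \<alpha>(2))
  also have "reassoc B t' ?N \<cdot> (((\<beta> \<star> \<iota> ?N) \<cdot> (\<iota> ?t \<star> reassoc B s n)) \<cdot> \<a> ?t ?s n) =
    (reassoc B t' ?N \<cdot> (\<beta> \<star> \<iota> ?N)) \<cdot> ((\<iota> ?t \<star> reassoc B s n) \<cdot> \<a> ?t ?s n)"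
    by simp
  also have "\<dots> = reassoc B (Then s t) n"
    unfolding \<beta>(2) by simp
  finally show ?thesis .
qed

text \<open>Each generator satisfies the equation by one of the preceding lemmas, and the commuting
  triangles can be pasted and inverted. The induction keeps n arbitrary because the horizontal case
  changes it.\<close>

lemma reassoc_canonical:
  assumes "canonical B s t \<alpha>" "n \<in> Arr B" "trg B n = src B (val B s)"
  shows "reassoc B t n \<cdot> (\<alpha> \<star> \<iota> n) = reassoc B s n"
  using assms
proof (induction arbitrary: n)
  case (canonical_assoc r s t)
  from canonical_assoc.hyps(1)
  have "trg B (val B r) = src B (val B s)" "formal B r" "formal B s" "formal B t"
    "trg B (val B s) = src B (val B t)" by auto
  with canonical_assoc.prems show ?case by (intro reassoc_canonical_assoc) simp_all
next
  case (canonical_lunit t)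
  then show ?case using reassoc_canonical_lunit[of t n] by simp
next
  case (canonical_runit t)
  then show ?case using reassoc_canonical_runit[of t n] by simp
next
  case (canonical_inverse s t \<alpha> \<beta>)
  note a = canonical_iso[OF canonical_inverse.hyps(1)] canonical_bounds[OF canonical_inverse.hyps(1)]
  have [simp]: "\<beta> \<in> Cell B" "cdom B \<beta> = val B t" "ccod B \<beta> = val B s" "\<alpha> \<cdot> \<beta> = \<iota> (val B t)"
    using canonical_inverse.hyps a by (auto simp: inverse_cells_def cells_def)
  note [simp] = a canonical_inverse.prems
  have n: "trg B n = src B (val B s)" using canonical_inverse.prems by simp
  \<comment> \<open>The induction hypothesis trades \<open>reassoc B s n\<close> for the
    reassociation of t after the whiskered \<alpha>, which \<beta> then cancels.\<close>
  have "reassoc B s n \<cdot> (\<beta> \<star> \<iota> n) = (reassoc B t n \<cdot> (\<alpha> \<star> \<iota> n)) \<cdot> (\<beta> \<star> \<iota> n)"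
    using canonical_inverse.IH[OF canonical_inverse.prems(1) n] by simp
  also have "\<dots> = reassoc B t n \<cdot> ((\<alpha> \<star> \<iota> n) \<cdot> (\<beta> \<star> \<iota> n))" by simp
  also have "\<dots> = reassoc B t n" by (simp add: interchange' del: vcomp_assoc')
  finally show ?case .
next
  case (canonical_vcomp r s \<alpha> t \<beta>)
  note [simp] = canonical_iso(1,2)[OF canonical_vcomp.hyps(1)] canonical_iso(1,2)[OF canonical_vcomp.hyps(2)]
    canonical_bounds[OF canonical_vcomp.hyps(1)] canonical_bounds[OF canonical_vcomp.hyps(2)]
    canonical_vcomp.prems
  have "(\<beta> \<cdot> \<alpha>) \<star> \<iota> n = (\<beta> \<star> \<iota> n) \<cdot> (\<alpha> \<star> \<iota> n)"
    by (simp add: interchange')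
  then have "reassoc B t n \<cdot> ((\<beta> \<cdot> \<alpha>) \<star> \<iota> n) = (reassoc B t n \<cdot> (\<beta> \<star> \<iota> n)) \<cdot> (\<alpha> \<star> \<iota> n)"
    by simp
  also have "\<dots> = reassoc B r n"
    using canonical_vcomp.IH by simp
  finally show ?case .
next
  case (canonical_hcomp s s' \<alpha> t t' \<beta>)
  note [simp] = fold_leaves[of s n]
  show ?case
    by (rule reassoc_canonical_hcomp) (use canonical_hcomp in auto)
qed simp

text \<open>With an identity arrow for n, both whiskered cells solve the same equation, whose
  coefficient \<open>reassoc B t n\<close> is invertible; whiskering with an identity is
  faithful.\<close>

theorem canonical_unique:
  assumes "canonical B s t \<alpha>" "canonical B s t \<beta>"
  shows "\<alpha> = \<beta>"
proof -
  note [simp] = canonical_iso(1,2)[OF assms(1)] canonical_bounds[OF assms(1)]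
    canonical_bounds(1-3)[OF assms(2)]
  let ?i = "\<one> (src B (val B s))"
  have "reassoc B t ?i \<cdot> (\<alpha> \<star> \<iota> ?i) = reassoc B t ?i \<cdot> (\<beta> \<star> \<iota> ?i)"
    using reassoc_canonical[OF assms(1), of ?i] reassoc_canonical[OF assms(2), of ?i] by simp
  from iso_cancel_left[OF reassoc_iso this] have "\<alpha> \<star> \<iota> ?i = \<beta> \<star> \<iota> ?i" by simp
  then show ?thesis by (rule hcomp_one_right_cancel) (auto simp: cells_def)
qed

subsection \<open>Isomorphic arrows and equivalences\<close>

text \<open>Inverses are unique by cancellation, so the definite description in
  \<open>cell_inv\<close> denotes the inverse.\<close>

lemma cell_inv_inverse:
  assumes "\<alpha> \<in> iso_cells B f g"
  shows "cell_inv B \<alpha> \<in> iso_cells B g f" "cell_inv B \<alpha> \<cdot> \<alpha> = \<iota> f" "\<alpha> \<cdot> cell_inv B \<alpha> = \<iota> g"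
proof -
  obtain \<beta> where b: "\<beta> \<in> iso_cells B g f" "\<beta> \<cdot> \<alpha> = \<iota> f" "\<alpha> \<cdot> \<beta> = \<iota> g"
    using assms by (rule iso_inverse)
  note [simp] = iso_cells_cell[OF assms] iso_cells_cell[OF b(1)]
  have "cell_inv B \<alpha> = \<beta>"
    unfolding cell_inv_def
  proof (rule the_equality)
    show "inverse_cells B \<alpha> \<beta>" using b by (simp add: inverse_cells_def cells_def)
    show "\<gamma> = \<beta>" if "inverse_cells B \<alpha> \<gamma>" for \<gamma>
      by (rule iso_cancel_left[OF assms]) (use that b in \<open>simp_all add: inverse_cells_def cells_def\<close>)
  qed
  with b show "cell_inv B \<alpha> \<in> iso_cells B g f" "cell_inv B \<alpha> \<cdot> \<alpha> = \<iota> f" "\<alpha> \<cdot> cell_inv B \<alpha> = \<iota> g"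
    by simp_all
qed

text \<open>Both are canonical cells from the formal composite of two units to one unit, so
  coherence identifies them.\<close>

lemma lunit_one_eq_runit_one:
  assumes "X \<in> Obj B"
  shows "\<l> (\<one> X) = \<r> (\<one> X)"
proof (rule canonical_unique)
  show "canonical B (Then (Unit X) (Unit X)) (Unit X) (\<l> (\<one> X))"
    using canonical_lunit[of B "Unit X"] assms by simp
  show "canonical B (Then (Unit X) (Unit X)) (Unit X) (\<r> (\<one> X))"
    using canonical_runit[of B "Unit X"] assms by simp
qed

text \<open>The left side is the 2-cell of the horizontal composite in the companion equation for
  squares p and c. An argument of Eckmann-Hilton type turns it into a vertical composite.\<close>

lemma hcomp_unit_conjugate:
  assumes f: "f \<in> Arr B" "src B f = X" "trg B f = X"
    and p: "p \<in> cells B (\<one> X) f" and c: "c \<in> cells B f (\<one> X)"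
  shows "\<l> f \<cdot> ((c \<star> p) \<cdot> cell_inv B (\<r> f)) = p \<cdot> c"
proof -
  have X: "X \<in> Obj B" using f arr_obj by auto
  have r: "\<r> f \<in> iso_cells B (f \<odot> \<one> X) f" using f by simp
  note i = cell_inv_inverse[OF r]
  have [simp]: "p \<in> Cell B" "cdom B p = \<one> X" "ccod B p = f" "c \<in> Cell B" "cdom B c = f" "ccod B c = \<one> X"
    using p c by (auto simp: cells_def)
  note [simp] = X f iso_cells_cell[OF i(1)]
  \<comment> \<open>The split lets c act first and passes through
    \<open>\<one> X \<odot> \<one> X\<close>, where the naturality squares of \<open>\<l>\<close>
    and \<open>\<r>\<close> can be joined.\<close>
  have "c \<star> p = (\<iota> (\<one> X) \<star> p) \<cdot> (c \<star> \<iota> (\<one> X))"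
    by (simp add: interchange')
  then have "\<l> f \<cdot> ((c \<star> p) \<cdot> cell_inv B (\<r> f)) =
    (\<l> f \<cdot> (\<iota> (\<one> X) \<star> p)) \<cdot> ((c \<star> \<iota> (\<one> X)) \<cdot> cell_inv B (\<r> f))"
    by simp
  also have "\<l> f \<cdot> (\<iota> (\<one> X) \<star> p) = p \<cdot> \<r> (\<one> X)"
    using lunit_natural'[of p] by (simp add: lunit_one_eq_runit_one)
  also have "(p \<cdot> \<r> (\<one> X)) \<cdot> ((c \<star> \<iota> (\<one> X)) \<cdot> cell_inv B (\<r> f)) =
    p \<cdot> ((\<r> (\<one> X) \<cdot> (c \<star> \<iota> (\<one> X))) \<cdot> cell_inv B (\<r> f))"
    by simp
  also have "\<r> (\<one> X) \<cdot> (c \<star> \<iota> (\<one> X)) = c \<cdot> \<r> f"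
    using runit_natural'[of c] by simp
  also have "p \<cdot> ((c \<cdot> \<r> f) \<cdot> cell_inv B (\<r> f)) = p \<cdot> c"
    by (simp add: i)
  finally show ?thesis .
qed

lemma isomorphic_arrows_refl: "f \<in> Arr B \<Longrightarrow> isomorphic_arrows B f f"
  using iso_cid unfolding isomorphic_arrows_def by blast

lemma isomorphic_arrows_sym: "isomorphic_arrows B f g \<Longrightarrow> isomorphic_arrows B g f"
  using iso_inverse unfolding isomorphic_arrows_def by (metis ex_in_conv)

lemma isomorphic_arrows_trans [trans]:
  "isomorphic_arrows B f g \<Longrightarrow> isomorphic_arrows B g h \<Longrightarrow> isomorphic_arrows B f h"
  using iso_vcomp unfolding isomorphic_arrows_def by (metis ex_in_conv)

lemma isomorphic_arrows_comp:
  "isomorphic_arrows B f f' \<Longrightarrow> isomorphic_arrows B g g' \<Longrightarrow> trg B f = src B g \<Longrightarrow>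
    isomorphic_arrows B (g \<odot> f) (g' \<odot> f')"
  using iso_hcomp unfolding isomorphic_arrows_def by (metis ex_in_conv)

lemma isomorphic_arrows_bounds:
  assumes "isomorphic_arrows B f g"
  shows "f \<in> Arr B" "g \<in> Arr B" "src B f = src B g" "trg B f = trg B g"
proof -
  obtain \<alpha> where "\<alpha> \<in> iso_cells B f g" using assms by (auto simp: isomorphic_arrows_def)
  then show "f \<in> Arr B" "g \<in> Arr B" "src B f = src B g" "trg B f = trg B g"
    using cell_arr[of \<alpha>] iso_cells_cell[of \<alpha> f g] by auto
qed

lemma isomorphic_arrows_assoc:
  "f \<in> Arr B \<Longrightarrow> g \<in> Arr B \<Longrightarrow> h \<in> Arr B \<Longrightarrow> trg B f = src B g \<Longrightarrow> trg B g = src B h \<Longrightarrow>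
    isomorphic_arrows B ((h \<odot> g) \<odot> f) (h \<odot> (g \<odot> f))"
  using assoc_iso unfolding isomorphic_arrows_def by blast

lemma isomorphic_arrows_unit:
  assumes "f \<in> Arr B"
  shows "isomorphic_arrows B (\<one> (trg B f) \<odot> f) f" "isomorphic_arrows B (f \<odot> \<one> (src B f)) f"
  using unit_iso assms unfolding isomorphic_arrows_def by blast+

text \<open>Both values reassociate to the fold of the common leaves over an identity arrow.
  Equality of the sources is assumed because an empty list of leaves does not determine an
  object.\<close>

lemma isomorphic_val:
  assumes "formal B s" "formal B t" "leaves s = leaves t" "src B (val B s) = src B (val B t)"
  shows "isomorphic_arrows B (val B s) (val B t)"
proof -
  let ?X = "src B (val B t)"
  have *: "isomorphic_arrows B (val B u) (fold (comp B) (leaves u) (\<one> ?X))"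
    if u: "formal B u" "src B (val B u) = ?X" for u
  proof (rule isomorphic_arrows_trans)
    show "isomorphic_arrows B (val B u) (val B u \<odot> \<one> ?X)"
      using isomorphic_arrows_sym[OF isomorphic_arrows_unit(2)[of "val B u"]] u by simp
    show "isomorphic_arrows B (val B u \<odot> \<one> ?X) (fold (comp B) (leaves u) (\<one> ?X))"
      using reassoc_iso[of u "\<one> ?X"] u assms(2) unfolding isomorphic_arrows_def by fastforce
  qed
  have "isomorphic_arrows B (val B s) (fold (comp B) (leaves t) (\<one> ?X))"
    using *[of s] assms by simp
  then show ?thesis
    using *[of t] assms isomorphic_arrows_sym isomorphic_arrows_trans by blast
qed

text \<open>A left and a right inverse agree up to isomorphism: g \<cong> g(fh) \<cong> (gf)h
  \<cong> h. Hence fg \<cong> fh is isomorphic to an identity, and g is inverse to f on both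
  sides.\<close>

lemma equivalence_from_one_sided_inverses:
  assumes f: "f \<in> Arr B" and g: "g \<in> hom B (trg B f) (src B f)" and h: "h \<in> hom B (trg B f) (src B f)"
    and gf: "isomorphic_arrows B (g \<odot> f) (\<one> (src B f))"
    and fh: "isomorphic_arrows B (f \<odot> h) (\<one> (trg B f))"
  shows "is_equivalence B f"
proof -
  have [simp]: "g \<in> Arr B" "src B g = trg B f" "trg B g = src B f"
    "h \<in> Arr B" "src B h = trg B f" "trg B h = src B f"
    using g h by (auto simp: hom_def)
  note [simp] = f isomorphic_arrows_refl
  have "isomorphic_arrows B g (g \<odot> \<one> (trg B f))"
    using isomorphic_arrows_unit(2)[of g] isomorphic_arrows_sym by simp
  also have "isomorphic_arrows B (g \<odot> \<one> (trg B f)) (g \<odot> (f \<odot> h))"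
    by (intro isomorphic_arrows_comp isomorphic_arrows_sym[OF fh]) simp_all
  also have "isomorphic_arrows B (g \<odot> (f \<odot> h)) ((g \<odot> f) \<odot> h)"
    by (intro isomorphic_arrows_sym[OF isomorphic_arrows_assoc]) simp_all
  also have "isomorphic_arrows B ((g \<odot> f) \<odot> h) (\<one> (src B f) \<odot> h)"
    by (intro isomorphic_arrows_comp gf) simp_all
  also have "isomorphic_arrows B (\<one> (src B f) \<odot> h) h"
    using isomorphic_arrows_unit(1)[of h] by simp
  finally have "isomorphic_arrows B (f \<odot> g) (f \<odot> h)"
    by (intro isomorphic_arrows_comp) simp_all
  then have "isomorphic_arrows B (f \<odot> g) (\<one> (trg B f))"
    using fh isomorphic_arrows_trans by blast
  with f g gf show ?thesis by (auto simp: is_equivalence_def)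
qed

end

subsection \<open>Paths\<close>

lemma path_obj_Cons:
  "path_obj B (X, f # fs) (Suc i) = path_obj B (trg B f, fs) i"
  by (cases i) (auto simp: path_obj_def)

lemma paths_Nil: "(X, []) \<in> paths B \<longleftrightarrow> X \<in> Obj B"
  by (simp add: paths_def path_length_def)

lemma path_obj_segment:
  assumes "i \<le> j" "j \<le> path_length P" "k \<le> j - i"
  shows "path_obj B (segment B P i j) k = path_obj B P (i + k)"
  using assms by (auto simp: path_obj_def segment_def path_length_def)

lemma path_length_segment:
  assumes "i \<le> j" "j \<le> path_length P"
  shows "path_length (segment B P i j) = j - i"
  using assms by (auto simp: segment_def path_length_def)

lemma path_append_segment:
  assumes "i \<le> j" "j \<le> k"
  shows "path_append (segment B P i j) (segment B P j k) = segment B P i k"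
proof -
  have "take (k - i) (drop i (snd P)) = take (j - i) (drop i (snd P)) @ take (k - j) (drop j (snd P))"
    using take_add[of "j - i" "k - j" "drop i (snd P)"] assms by simp
  then show ?thesis by (simp add: path_append_def segment_def)
qed

context bicategory
begin

text \<open>Together with \<open>paths_append\<close> this replaces the indexed composability
  condition by one that follows the list structure, the form suited to induction.\<close>

lemma paths_Cons:
  "(X, f # fs) \<in> paths B \<longleftrightarrow> f \<in> Arr B \<and> src B f = X \<and> (trg B f, fs) \<in> paths B"
  by (auto simp: paths_def path_length_def path_obj_Cons All_less_Suc2 arr_bounds)
    (auto simp: path_obj_def)

lemma paths_append:
  "(X, fs @ gs) \<in> paths B \<longleftrightarrow>
    (X, fs) \<in> paths B \<and> (path_obj B (X, fs) (length fs), gs) \<in> paths B"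
proof (induction fs arbitrary: X)
  case Nil
  then show ?case by (auto simp: path_obj_def paths_def path_length_def)
qed (auto simp: paths_Cons path_obj_Cons)

lemma path_obj_append:
  "path_obj B (X, fs @ gs) (length fs + i) = path_obj B (path_obj B (X, fs) (length fs), gs) i"
  by (induction fs arbitrary: X) (auto simp: path_obj_Cons, simp add: path_obj_def)

text \<open>Composability of the leaves carries over to the bracketing; a \<open>Unit\<close> could
  sit at an unrelated object, so it has to be excluded. X is kept general since the second factor
  starts where the leaves of the first end.\<close>

lemma formal_unit_free:
  assumes "unit_free t" "(X, leaves t) \<in> paths B"
  shows "formal B t \<and> src B (val B t) = X \<and>
    trg B (val B t) = path_obj B (X, leaves t) (length (leaves t))"
  using assms
proof (induction t arbitrary: X)
  case (Single f)
  then show ?case by (auto simp: paths_Cons path_obj_def)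
next
  case (Then s t)
  let ?Y = "path_obj B (X, leaves s) (length (leaves s))"
  have "(X, leaves s) \<in> paths B" "(?Y, leaves t) \<in> paths B"
    using Then.prems paths_append by auto
  with Then.IH Then.prems show ?case
    by (auto simp: path_obj_append)
qed simp

lemma segment_in_paths:
  assumes "P \<in> paths B" "i \<le> j" "j \<le> path_length P"
  shows "segment B P i j \<in> paths B"
proof -
  obtain X fs where P: "P = (X, fs)" by (cases P)
  \<comment> \<open>The list is cut into prefix, segment and suffix; \<open>paths_append\<close>
    then shows that the segment is a path from the end of the prefix.\<close>
  have fs: "fs = take i fs @ take (j - i) (drop i fs) @ drop j fs"
    using assms(2) by (metis append_take_drop_id drop_drop le_add_diff_inverse2)
  have l: "i \<le> length fs" using assms by (simp add: P path_length_def)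
  have "path_obj B (X, take i fs) i = path_obj B (X, fs) i"
    using assms by (auto simp: path_obj_def)
  moreover have "(path_obj B (X, take i fs) i, take (j - i) (drop i fs)) \<in> paths B"
    using assms(1) unfolding P by (subst (asm) fs)
      (simp add: paths_append min.absorb2[OF l] del: append_take_drop_id)
  ultimately show ?thesis by (simp add: segment_def P)
qed

end

subsection \<open>Companions in the double category of marked paths\<close>

locale bicategory_with_composites = bicategory B
  for B :: "('o, 'a, 'c, 'z) bicat_scheme" (structure) +
  fixes \<phi> :: "('o, 'a) path \<Rightarrow> ('o, 'a) bracketing"
  assumes composite_choice: "composite_choice B \<phi>"
begin

lemma choice:
  assumes "P \<in> paths B"
  shows "formal B (\<phi> P)" "src B (val B (\<phi> P)) = fst P"
    "trg B (val B (\<phi> P)) = path_obj B P (path_length P)" "leaves (\<phi> P) = snd P"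
proof -
  have "formal B (\<phi> P) \<and> src B (val B (\<phi> P)) = fst P \<and>
    trg B (val B (\<phi> P)) = path_obj B P (path_length P) \<and> leaves (\<phi> P) = snd P"
  proof (cases "snd P = []")
    case True
    then have "\<phi> P = Unit (fst P)"
      using composite_choice assms by (simp add: composite_choice_def)
    then show ?thesis
      using assms True by (simp add: paths_def path_obj_def path_length_def)
  next
    case False
    then have "unit_free (\<phi> P)" "leaves (\<phi> P) = snd P"
      using composite_choice assms by (simp_all add: composite_choice_def)
    with formal_unit_free[of "\<phi> P" "fst P"] assms show ?thesis by (simp add: path_length_def)
  qed
  then show "formal B (\<phi> P)" "src B (val B (\<phi> P)) = fst P"
    "trg B (val B (\<phi> P)) = path_obj B P (path_length P)" "leaves (\<phi> P) = snd P" by auto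
qed

lemma choice_Nil: "X \<in> Obj B \<Longrightarrow> \<phi> (X, []) = Unit X"
  using composite_choice by (auto simp: composite_choice_def paths_Nil)

text \<open>This lets any convenient bracketing of a path stand in for the chosen one.\<close>

lemma choice_isomorphic:
  assumes "P \<in> paths B" "formal B t" "leaves t = snd P" "src B (val B t) = fst P"
  shows "isomorphic_arrows B (val B (\<phi> P)) (val B t)"
  by (rule isomorphic_val) (use assms choice in auto)

text \<open>The unit cell is a canonical cell of the required type, hence the one selected by
  \<open>comparison\<close>. It is a right unit cell because the left argument of
  \<open>Then\<close> is the arrow applied first.\<close>

lemma comparison_empty_left:
  assumes "P \<in> paths B"
  shows "comparison B \<phi> (fst P, []) P = \<r> (val B (\<phi> P))"
proof -
  have "canonical B (Then (Unit (fst P)) (\<phi> P)) (\<phi> P) (\<r> (val B (\<phi> P)))"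
    using canonical_runit[of B "\<phi> P"] choice[OF assms] by simp
  then have "canonical B (Then (\<phi> (fst P, [])) (\<phi> P)) (\<phi> (path_append (fst P, []) P)) (\<r> (val B (\<phi> P)))"
    using assms by (simp add: path_append_def choice_Nil paths_def)
  then show ?thesis
    unfolding comparison_def by (blast intro: canonical_unique)
qed

lemma comparison_empty_right:
  assumes "P \<in> paths B"
  shows "comparison B \<phi> P (path_obj B P (path_length P), []) = \<l> (val B (\<phi> P))"
proof -
  let ?Y = "path_obj B P (path_length P)"
  have Y: "?Y \<in> Obj B"
    using choice[OF assms] arr_obj(2)[of "val B (\<phi> P)"] by simp
  have "canonical B (Then (\<phi> P) (Unit ?Y)) (\<phi> P) (\<l> (val B (\<phi> P)))"
    using canonical_lunit[of B "\<phi> P"] choice[OF assms] by simp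
  then have "canonical B (Then (\<phi> P) (\<phi> (?Y, []))) (\<phi> (path_append P (?Y, []))) (\<l> (val B (\<phi> P)))"
    by (simp add: path_append_def choice_Nil Y)
  then show ?thesis
    unfolding comparison_def by (blast intro: canonical_unique)
qed

section \<open>Vertically invertible squares and companions in terms of 2-cells\<close>

lemma harr_Dbl: "(P, i, j) \<in> harr (Dbl B \<phi>) \<longleftrightarrow> P \<in> paths B \<and> i \<le> j \<and> j \<le> path_length P"
  by (simp add: Dbl_def)

lemma composite_bounds:
  assumes "(P, i, j) \<in> harr (Dbl B \<phi>)"
  shows "val B (\<phi> (segment B P i j)) \<in> Arr B"
    "src B (val B (\<phi> (segment B P i j))) = path_obj B P i"
    "trg B (val B (\<phi> (segment B P i j))) = path_obj B P j"
proof -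
  have P: "P \<in> paths B" "i \<le> j" "j \<le> path_length P" using assms by (simp_all add: harr_Dbl)
  note c = choice[OF segment_in_paths[OF P]]
  show "val B (\<phi> (segment B P i j)) \<in> Arr B"
    "src B (val B (\<phi> (segment B P i j))) = path_obj B P i"
    "trg B (val B (\<phi> (segment B P i j))) = path_obj B P j"
    using c P by (simp_all add: path_length_segment path_obj_segment) (simp add: segment_def)
qed

text \<open>A square carries a 2-cell between chosen composites, and vertical composition of squares
  is that of the 2-cells.\<close>

lemma vertically_invertible_iff:
  "(\<exists>\<sigma>. vertically_invertible (Dbl B \<phi>) \<sigma> \<and> sq_top (Dbl B \<phi>) \<sigma> = (P, i, j) \<and>
      sq_bottom (Dbl B \<phi>) \<sigma> = (Q, m, n)) \<longleftrightarrow>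
    (P, i, j) \<in> harr (Dbl B \<phi>) \<and> (Q, m, n) \<in> harr (Dbl B \<phi>) \<and>
    isomorphic_arrows B (val B (\<phi> (segment B P i j))) (val B (\<phi> (segment B Q m n)))"
    (is "?L \<longleftrightarrow> _ \<and> _ \<and> isomorphic_arrows B ?F ?G" is "_ \<longleftrightarrow> ?R")
proof
  assume ?L
  then obtain \<sigma> \<tau> where sq: "\<sigma> \<in> squares (Dbl B \<phi>)" "\<tau> \<in> squares (Dbl B \<phi>)"
    and b: "sq_top (Dbl B \<phi>) \<sigma> = (P, i, j)" "sq_bottom (Dbl B \<phi>) \<sigma> = (Q, m, n)"
      "sq_top (Dbl B \<phi>) \<tau> = (Q, m, n)" "sq_bottom (Dbl B \<phi>) \<tau> = (P, i, j)"
    and inv: "sq_vcomp (Dbl B \<phi>) \<tau> \<sigma> = sq_vid (Dbl B \<phi>) (P, i, j)"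
      "sq_vcomp (Dbl B \<phi>) \<sigma> \<tau> = sq_vid (Dbl B \<phi>) (Q, m, n)"
    unfolding vertically_invertible_def by metis
  obtain \<alpha> \<beta> where c: "\<sigma> = ((P, i, j), (Q, m, n), \<alpha>)" "\<tau> = ((Q, m, n), (P, i, j), \<beta>)"
    using b by (cases \<sigma>, cases \<tau>) (simp add: Dbl_def)
  have "\<alpha> \<in> cells B ?F ?G" "\<beta> \<in> cells B ?G ?F" "(P, i, j) \<in> harr (Dbl B \<phi>)" "(Q, m, n) \<in> harr (Dbl B \<phi>)"
    using sq unfolding c by (simp_all add: Dbl_def chosen_composite_def)
  moreover have "\<beta> \<cdot> \<alpha> = \<iota> ?F" "\<alpha> \<cdot> \<beta> = \<iota> ?G"
    using inv unfolding c by (simp_all add: Dbl_def chosen_composite_def)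
  ultimately have "(P, i, j) \<in> harr (Dbl B \<phi>)" "(Q, m, n) \<in> harr (Dbl B \<phi>)" "\<alpha> \<in> iso_cells B ?F ?G"
    by (auto simp: iso_cells_iff cells_def)
  then show ?R unfolding isomorphic_arrows_def by blast
next
  assume R: ?R
  from R obtain \<alpha> where "\<alpha> \<in> iso_cells B ?F ?G"
    by (auto simp: isomorphic_arrows_def)
  then obtain \<beta> where ab: "\<alpha> \<in> cells B ?F ?G" "\<beta> \<in> cells B ?G ?F"
    "\<beta> \<cdot> \<alpha> = \<iota> ?F" "\<alpha> \<cdot> \<beta> = \<iota> ?G"
    by (auto simp: iso_cells_iff cells_def)
  \<comment> \<open>A square needs matching marked objects; these match because isomorphic arrows
    are parallel.\<close>
  have o: "path_obj B P i = path_obj B Q m" "path_obj B P j = path_obj B Q n"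
    using R isomorphic_arrows_bounds[of ?F ?G] composite_bounds[of P i j] composite_bounds[of Q m n]
    by auto
  have h: "P \<in> paths B" "i \<le> j" "j \<le> path_length P" "Q \<in> paths B" "m \<le> n" "n \<le> path_length Q"
    using R by (auto simp: harr_Dbl)
  let ?\<sigma> = "((P, i, j), (Q, m, n), \<alpha>)" and ?\<tau> = "((Q, m, n), (P, i, j), \<beta>)"
  have "?\<sigma> \<in> squares (Dbl B \<phi>)" "?\<tau> \<in> squares (Dbl B \<phi>)"
    using ab o h by (simp_all add: Dbl_def chosen_composite_def)
  then have "vertically_invertible (Dbl B \<phi>) ?\<sigma>"
    using ab unfolding vertically_invertible_def
    by (intro conjI bexI[of _ ?\<tau>]) (simp_all add: Dbl_def chosen_composite_def)
  then show ?L
    by (intro exI[of _ ?\<sigma>]) (simp add: Dbl_def)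
qed

lemma composite_empty_segment:
  assumes "P \<in> paths B" "i \<le> path_length P"
  shows "val B (\<phi> (segment B P i i)) = \<one> (path_obj B P i)"
proof -
  have "path_obj B P i \<in> Obj B"
    using composite_bounds[of P i i] assms arr_obj(1)[of "val B (\<phi> (segment B P i i))"]
    by (simp add: harr_Dbl)
  then show ?thesis by (simp add: segment_def choice_Nil)
qed

text \<open>A vertical arrow between the two ends exists only if the marked objects agree. The
  squares \<psi> and \<chi> are then 2-cells p and c between an identity and the composite; the
  vertical equation says that c after p is an identity, and by \<open>hcomp_unit_conjugate\<close>
  the horizontal one says the same of p after c.\<close>

lemma is_companion_iff:
  assumes "(P, i, j) \<in> harr (Dbl B \<phi>)"
  shows "is_companion (Dbl B \<phi>) (P, i, j) \<longleftrightarrow>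
    path_obj B P i = path_obj B P j \<and>
    isomorphic_arrows B (val B (\<phi> (segment B P i j))) (\<one> (path_obj B P i))"
    (is "?L \<longleftrightarrow> ?R")
proof -
  let ?D = "Dbl B \<phi>" and ?F = "val B (\<phi> (segment B P i j))" and ?X = "path_obj B P i"
  let ?v = "((P, i), (P, j))"
  have h: "P \<in> paths B" "i \<le> j" "j \<le> path_length P" "i \<le> path_length P"
    using assms by (simp_all add: harr_Dbl)
  note F = composite_bounds[OF assms]
  have s: "val B (\<phi> (segment B P i i)) = \<one> ?X" "val B (\<phi> (segment B P j j)) = \<one> (path_obj B P j)"
    using composite_empty_segment h by simp_all
  have S: "segment B P i j \<in> paths B" using segment_in_paths h by simp
  \<comment> \<open>In the horizontal composite of \<chi> and \<psi> the tops are the segments from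
    i to i and from i to j, the bottoms those from i to j and from j to j. Both comparisons thus
    involve an empty segment and are unit cells.\<close>
  have l: "comparison B \<phi> (segment B P i i) (segment B P i j) = \<r> ?F"
    using comparison_empty_left[OF S] by (simp add: segment_def)
  have r: "comparison B \<phi> (segment B P i j) (segment B P j j) = \<l> ?F"
    using comparison_empty_right[OF S] h
    by (simp add: path_length_segment path_obj_segment) (simp add: segment_def)
  have hcomp: "sq_hcomp ?D ((P, i, j), (P, j, j), c) ((P, i, i), (P, i, j), p) =
      ((P, i, j), (P, i, j), \<l> ?F \<cdot> ((c \<star> p) \<cdot> cell_inv B (\<r> ?F)))" for c p
    by (simp add: Dbl_def marked_comparison_def l r)
  have vid: "sq_vid ?D (P, i, j) = ((P, i, j), (P, i, j), \<iota> ?F)"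
    by (simp add: Dbl_def chosen_composite_def)
  show ?thesis
  proof
    assume ?L
    then obtain v \<psi> \<chi> where v: "v \<in> varr ?D" "vdom ?D v = (P, i)" "vcod ?D v = (P, j)"
      and sq: "\<psi> \<in> squares ?D" "\<chi> \<in> squares ?D"
      and \<psi>: "sq_top ?D \<psi> = (P, i, i)" "sq_bottom ?D \<psi> = (P, i, j)"
      and \<chi>: "sq_top ?D \<chi> = (P, i, j)" "sq_bottom ?D \<chi> = (P, j, j)"
      and eq: "sq_hcomp ?D \<chi> \<psi> = sq_vid ?D (P, i, j)" "sq_vcomp ?D \<chi> \<psi> = sq_hid ?D v"
      by (auto simp: is_companion_def companions_def Dbl_def)
    have v': "v = ?v" and X: "path_obj B P i = path_obj B P j"
      using v by (auto simp: Dbl_def)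
    obtain p where p: "\<psi> = ((P, i, i), (P, i, j), p)" "p \<in> cells B (\<one> ?X) ?F"
      using sq(1) \<psi> s by (cases \<psi>) (auto simp: Dbl_def chosen_composite_def)
    obtain c where c: "\<chi> = ((P, i, j), (P, j, j), c)" "c \<in> cells B ?F (\<one> ?X)"
      using sq(2) \<chi> s X by (cases \<chi>) (auto simp: Dbl_def chosen_composite_def)
    have cp: "c \<cdot> p = \<iota> (\<one> ?X)"
      using eq(2) unfolding p c v' by (simp add: Dbl_def)
    have "p \<cdot> c = \<iota> ?F"
      using eq(1) hcomp_unit_conjugate[OF F(1,2) _ p(2) c(2)] F(3) X
      unfolding p(1) c(1) hcomp vid by simp
    then have "c \<in> iso_cells B ?F (\<one> ?X)"
      using cp p c by (auto simp: iso_cells_iff cells_def)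
    with X show ?R by (auto simp: isomorphic_arrows_def)
  next
    assume R: ?R
    then have X: "path_obj B P j = ?X" by simp
    from R obtain c where "c \<in> iso_cells B ?F (\<one> ?X)"
      by (auto simp: isomorphic_arrows_def)
    then obtain p where c: "c \<in> cells B ?F (\<one> ?X)" and p: "p \<in> cells B (\<one> ?X) ?F"
      and pc: "p \<cdot> c = \<iota> ?F" and cp: "c \<cdot> p = \<iota> (\<one> ?X)"
      by (auto simp: iso_cells_iff cells_def)
    let ?\<psi> = "((P, i, i), (P, i, j), p)" and ?\<chi> = "((P, i, j), (P, j, j), c)"
    have "?\<psi> \<in> squares ?D" "?\<chi> \<in> squares ?D"
      using h c p s X by (simp_all add: Dbl_def chosen_composite_def)
    moreover have "sq_hcomp ?D ?\<chi> ?\<psi> = sq_vid ?D (P, i, j)"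
      unfolding hcomp vid using hcomp_unit_conjugate[OF F(1,2) _ p c] F(3) X pc by simp
    moreover have "sq_vcomp ?D ?\<chi> ?\<psi> = sq_hid ?D ?v"
      using cp by (simp add: Dbl_def)
    moreover have "?v \<in> varr ?D" using h X by (simp add: Dbl_def)
    ultimately have "companions ?D (P, i, j) ?v"
      unfolding companions_def using assms
      by (intro conjI bexI[of _ ?\<psi>] bexI[of _ ?\<chi>]) (simp_all add: Dbl_def)
    then show ?L unfolding is_companion_def by blast
  qed
qed

text \<open>Joining the chosen bracketings of two adjacent segments by \<open>Then\<close> gives a
  bracketing of the whole segment.\<close>

lemma composite_segments:
  assumes "(P, i, j) \<in> harr (Dbl B \<phi>)" "(P, j, k) \<in> harr (Dbl B \<phi>)"
  shows "isomorphic_arrows B (val B (\<phi> (segment B P i k)))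
    (val B (\<phi> (segment B P j k)) \<odot> val B (\<phi> (segment B P i j)))"
proof -
  have h: "P \<in> paths B" "i \<le> j" "j \<le> k" "k \<le> path_length P" "i \<le> k" "j \<le> path_length P"
    using assms by (simp_all add: harr_Dbl)
  note c = choice[OF segment_in_paths[OF h(1,2,6)]] choice[OF segment_in_paths[OF h(1,3,4)]]
  note [simp] = composite_bounds[OF assms(1)] composite_bounds[OF assms(2)]
  have "isomorphic_arrows B (val B (\<phi> (segment B P i k)))
    (val B (Then (\<phi> (segment B P i j)) (\<phi> (segment B P j k))))"
  proof (rule choice_isomorphic)
    show "segment B P i k \<in> paths B" using segment_in_paths h by simp
    show "formal B (Then (\<phi> (segment B P i j)) (\<phi> (segment B P j k)))" using c by simp
    show "leaves (Then (\<phi> (segment B P i j)) (\<phi> (segment B P j k))) = snd (segment B P i k)"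
      using c path_append_segment[of i j k B P] h by (simp add: path_append_def prod_eq_iff)
    show "src B (val B (Then (\<phi> (segment B P i j)) (\<phi> (segment B P j k)))) = fst (segment B P i k)"
      by (simp add: segment_def[of B P i k])
  qed
  then show ?thesis by simp
qed

section \<open>Pre-companions and one-sided inverses\<close>

lemma left_pre_companionE:
  assumes "left_pre_companion (Dbl B \<phi>) h"
  obtains Q k m n where "(Q, k, m) \<in> harr (Dbl B \<phi>)" "(Q, m, n) \<in> harr (Dbl B \<phi>)"
    "\<exists>\<sigma>. vertically_invertible (Dbl B \<phi>) \<sigma> \<and> sq_top (Dbl B \<phi>) \<sigma> = h \<and>
      sq_bottom (Dbl B \<phi>) \<sigma> = (Q, k, m)"
    "is_companion (Dbl B \<phi>) (Q, k, n)"
proof -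
  from assms obtain f g \<sigma> where f: "f \<in> harr (Dbl B \<phi>)" and g: "g \<in> harr (Dbl B \<phi>)"
    and fg: "hcod (Dbl B \<phi>) f = hdom (Dbl B \<phi>) g"
    and \<sigma>: "vertically_invertible (Dbl B \<phi>) \<sigma>" "sq_top (Dbl B \<phi>) \<sigma> = h"
      "sq_bottom (Dbl B \<phi>) \<sigma> = f"
    and c: "is_companion (Dbl B \<phi>) (harr_comp (Dbl B \<phi>) g f)"
    unfolding left_pre_companion_def by metis
  obtain Q k m where f': "f = (Q, k, m)" by (cases f)
  \<comment> \<open>Composability forces the second factor to lie on the same path and to start at
    the mark m.\<close>
  obtain n where g': "g = (Q, m, n)" using fg f' by (cases g) (simp add: Dbl_def)
  have "harr_comp (Dbl B \<phi>) g f = (Q, k, n)" by (simp add: f' g' Dbl_def)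
  with that f g \<sigma> c f' g' show thesis by metis
qed

text \<open>Prolonging a segment composes its composite with another arrow on the left, and the
  result is a companion only if that composition is isomorphic to an identity.\<close>

lemma left_pre_companion_iff:
  assumes "(P, i, j) \<in> harr (Dbl B \<phi>)"
  defines "F \<equiv> val B (\<phi> (segment B P i j))"
  shows "left_pre_companion (Dbl B \<phi>) (P, i, j) \<longleftrightarrow>
    (\<exists>g \<in> hom B (trg B F) (src B F). isomorphic_arrows B (g \<odot> F) (\<one> (src B F)))"
    (is "?L \<longleftrightarrow> ?R")
proof -
  let ?D = "Dbl B \<phi>"
  note F = composite_bounds[OF assms(1), folded F_def]
  note O = arr_obj[OF F(1), unfolded F(2,3)]
  show ?thesis
  proof
    assume ?L
    then obtain Q k m n where h: "(Q, k, m) \<in> harr ?D" "(Q, m, n) \<in> harr ?D"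
      and i: "\<exists>\<sigma>. vertically_invertible ?D \<sigma> \<and> sq_top ?D \<sigma> = (P, i, j) \<and> sq_bottom ?D \<sigma> = (Q, k, m)"
      and c: "is_companion ?D (Q, k, n)"
      by (rule left_pre_companionE)
    \<comment> \<open>The prolonging segment of Q supplies the left inverse
      \<open>?g\<close>.\<close>
    let ?F' = "val B (\<phi> (segment B Q k m))" and ?g = "val B (\<phi> (segment B Q m n))"
    have FF: "isomorphic_arrows B F ?F'"
      using i unfolding vertically_invertible_iff F_def by simp
    have kn: "(Q, k, n) \<in> harr ?D" using h by (auto simp: harr_Dbl)
    note b = composite_bounds[OF h(1)] composite_bounds[OF h(2)] isomorphic_arrows_bounds[OF FF]
    \<comment> \<open>Equal marked objects at the ends make \<open>?g\<close> lead back to the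
      source of F.\<close>
    have X: "path_obj B Q k = path_obj B Q n"
      and c': "isomorphic_arrows B (val B (\<phi> (segment B Q k n))) (\<one> (path_obj B Q k))"
      using c unfolding is_companion_iff[OF kn] by blast+
    have "isomorphic_arrows B (?g \<odot> F) (?g \<odot> ?F')"
      using FF b by (intro isomorphic_arrows_comp isomorphic_arrows_refl) simp_all
    also have "isomorphic_arrows B (?g \<odot> ?F') (val B (\<phi> (segment B Q k n)))"
      using composite_segments[OF h] by (rule isomorphic_arrows_sym)
    also note c'
    finally show ?R
      using b X by (intro bexI[of _ ?g]) (simp_all add: hom_def)
  next
    assume ?R
    then obtain g where g: "g \<in> Arr B" "src B g = trg B F" "trg B g = src B F"
      and gF: "isomorphic_arrows B (g \<odot> F) (\<one> (src B F))"
      by (auto simp: hom_def)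
    \<comment> \<open>The composite F becomes a single arrow of a new path. Its segment between the
      marks 0 and 1 has composite F up to isomorphism, and the whole path has composite
      \<open>g \<odot> F\<close>.\<close>
    let ?Q = "(src B F, [F, g])"
    have Q: "?Q \<in> paths B" "(src B F, [F]) \<in> paths B"
      using F g O by (simp_all add: paths_Cons paths_Nil)
    have S: "segment B ?Q 0 1 = (src B F, [F])" "segment B ?Q 0 2 = ?Q"
      by (simp_all add: segment_def path_obj_def)
    have h: "(?Q, 0, 1) \<in> harr ?D" "(?Q, 1, 2) \<in> harr ?D" "(?Q, 0, 2) \<in> harr ?D"
      using Q by (simp_all add: harr_Dbl path_length_def)
    have "isomorphic_arrows B F (val B (\<phi> (segment B ?Q 0 1)))"
      using isomorphic_arrows_sym[OF choice_isomorphic[OF Q(2), of "Single F"]] F S by simp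
    then have i: "\<exists>\<sigma>. vertically_invertible ?D \<sigma> \<and> sq_top ?D \<sigma> = (P, i, j) \<and> sq_bottom ?D \<sigma> = (?Q, 0, 1)"
      unfolding vertically_invertible_iff using assms h by simp
    have "isomorphic_arrows B (val B (\<phi> ?Q)) (g \<odot> F)"
      using choice_isomorphic[OF Q(1), of "Then (Single F) (Single g)"] F g by simp
    also note gF
    finally have "is_companion ?D (?Q, 0, 2)"
      unfolding is_companion_iff[OF h(3)] using S g by (simp add: path_obj_def)
    then have c: "is_companion ?D (harr_comp ?D (?Q, 1, 2) (?Q, 0, 1))"
      by (simp add: Dbl_def)
    have "hdom ?D (?Q, 1, 2) = hcod ?D (?Q, 0, 1)" by (simp add: Dbl_def)
    with i c h assms(1) show ?L
      unfolding left_pre_companion_def by blast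
  qed
qed

lemma right_pre_companionE:
  assumes "right_pre_companion (Dbl B \<phi>) h"
  obtains Q k m n where "(Q, k, m) \<in> harr (Dbl B \<phi>)" "(Q, m, n) \<in> harr (Dbl B \<phi>)"
    "\<exists>\<sigma>. vertically_invertible (Dbl B \<phi>) \<sigma> \<and> sq_top (Dbl B \<phi>) \<sigma> = h \<and>
      sq_bottom (Dbl B \<phi>) \<sigma> = (Q, m, n)"
    "is_companion (Dbl B \<phi>) (Q, k, n)"
proof -
  from assms obtain f g \<sigma> where f: "f \<in> harr (Dbl B \<phi>)" and g: "g \<in> harr (Dbl B \<phi>)"
    and fg: "hcod (Dbl B \<phi>) f = hdom (Dbl B \<phi>) g"
    and \<sigma>: "vertically_invertible (Dbl B \<phi>) \<sigma>" "sq_top (Dbl B \<phi>) \<sigma> = h"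
      "sq_bottom (Dbl B \<phi>) \<sigma> = g"
    and c: "is_companion (Dbl B \<phi>) (harr_comp (Dbl B \<phi>) g f)"
    unfolding right_pre_companion_def by metis
  obtain Q k m where f': "f = (Q, k, m)" by (cases f)
  obtain n where g': "g = (Q, m, n)" using fg f' by (cases g) (simp add: Dbl_def)
  have "harr_comp (Dbl B \<phi>) g f = (Q, k, n)" by (simp add: f' g' Dbl_def)
  with that f g \<sigma> c f' g' show thesis by metis
qed

text \<open>The mirror image of the left case: the segment is prolonged at its beginning, which
  composes on the right.\<close>

lemma right_pre_companion_iff:
  assumes "(P, i, j) \<in> harr (Dbl B \<phi>)"
  defines "F \<equiv> val B (\<phi> (segment B P i j))"
  shows "right_pre_companion (Dbl B \<phi>) (P, i, j) \<longleftrightarrow>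
    (\<exists>g \<in> hom B (trg B F) (src B F). isomorphic_arrows B (F \<odot> g) (\<one> (trg B F)))"
    (is "?L \<longleftrightarrow> ?R")
proof -
  let ?D = "Dbl B \<phi>"
  note F = composite_bounds[OF assms(1), folded F_def]
  note O = arr_obj[OF F(1), unfolded F(2,3)]
  show ?thesis
  proof
    assume ?L
    then obtain Q k m n where h: "(Q, k, m) \<in> harr ?D" "(Q, m, n) \<in> harr ?D"
      and i: "\<exists>\<sigma>. vertically_invertible ?D \<sigma> \<and> sq_top ?D \<sigma> = (P, i, j) \<and> sq_bottom ?D \<sigma> = (Q, m, n)"
      and c: "is_companion ?D (Q, k, n)"
      by (rule right_pre_companionE)
    \<comment> \<open>Now the first of the two segments supplies the inverse.\<close>
    let ?g = "val B (\<phi> (segment B Q k m))" and ?F' = "val B (\<phi> (segment B Q m n))"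
    have FF: "isomorphic_arrows B F ?F'"
      using i unfolding vertically_invertible_iff F_def by simp
    have kn: "(Q, k, n) \<in> harr ?D" using h by (auto simp: harr_Dbl)
    note b = composite_bounds[OF h(1)] composite_bounds[OF h(2)] isomorphic_arrows_bounds[OF FF]
    have X: "path_obj B Q k = path_obj B Q n"
      and c': "isomorphic_arrows B (val B (\<phi> (segment B Q k n))) (\<one> (path_obj B Q k))"
      using c unfolding is_companion_iff[OF kn] by blast+
    have "isomorphic_arrows B (F \<odot> ?g) (?F' \<odot> ?g)"
      using FF b by (intro isomorphic_arrows_comp isomorphic_arrows_refl) simp_all
    also have "isomorphic_arrows B (?F' \<odot> ?g) (val B (\<phi> (segment B Q k n)))"
      using composite_segments[OF h] by (rule isomorphic_arrows_sym)
    also note c'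
    finally show ?R
      using b X by (intro bexI[of _ ?g]) (simp_all add: hom_def)
  next
    assume ?R
    then obtain g where g: "g \<in> Arr B" "src B g = trg B F" "trg B g = src B F"
      and Fg: "isomorphic_arrows B (F \<odot> g) (\<one> (trg B F))"
      by (auto simp: hom_def)
    \<comment> \<open>Here g comes first, so F lies between the marks 1 and 2.\<close>
    let ?Q = "(trg B F, [g, F])"
    have Q: "?Q \<in> paths B" "(src B F, [F]) \<in> paths B"
      using F g O by (simp_all add: paths_Cons paths_Nil)
    have S: "segment B ?Q 1 2 = (src B F, [F])" "segment B ?Q 0 2 = ?Q"
      using g by (simp_all add: segment_def path_obj_def)
    have h: "(?Q, 0, 1) \<in> harr ?D" "(?Q, 1, 2) \<in> harr ?D" "(?Q, 0, 2) \<in> harr ?D"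
      using Q by (simp_all add: harr_Dbl path_length_def)
    have "isomorphic_arrows B F (val B (\<phi> (segment B ?Q 1 2)))"
      using isomorphic_arrows_sym[OF choice_isomorphic[OF Q(2), of "Single F"]] F S by simp
    then have i: "\<exists>\<sigma>. vertically_invertible ?D \<sigma> \<and> sq_top ?D \<sigma> = (P, i, j) \<and> sq_bottom ?D \<sigma> = (?Q, 1, 2)"
      unfolding vertically_invertible_iff using assms h by simp
    have "isomorphic_arrows B (val B (\<phi> ?Q)) (F \<odot> g)"
      using choice_isomorphic[OF Q(1), of "Then (Single g) (Single F)"] F g by simp
    also note Fg
    finally have "is_companion ?D (?Q, 0, 2)"
      unfolding is_companion_iff[OF h(3)] using S g by (simp add: path_obj_def)
    then have c: "is_companion ?D (harr_comp ?D (?Q, 1, 2) (?Q, 0, 1))"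
      by (simp add: Dbl_def)
    have "hcod ?D (?Q, 0, 1) = hdom ?D (?Q, 1, 2)" by (simp add: Dbl_def)
    with i c h assms(1) show ?L
      unfolding right_pre_companion_def by blast
  qed
qed

end

section \<open>Pre-companions are the marked paths whose composite is an equivalence\<close>

theorem proposition6p13:
  fixes B :: "('o, 'a, 'c) bicat"
    and \<phi> :: "('o, 'a) path \<Rightarrow> ('o, 'a) bracketing"
    and P :: "('o, 'a) path"
    and i\<^sub>0 i\<^sub>1 :: nat
  assumes "bicategory B"
    and "composite_choice B \<phi>"
    and "(P, i\<^sub>0, i\<^sub>1) \<in> harr (Dbl B \<phi>)"
  shows "pre_companion (Dbl B \<phi>) (P, i\<^sub>0, i\<^sub>1) \<longleftrightarrow>
    is_equivalence B (val B (\<phi> (segment B P i\<^sub>0 i\<^sub>1)))"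
proof -
  interpret bicategory_with_composites B \<phi>
    using assms(1,2) by (simp add: bicategory_with_composites_def bicategory_with_composites_axioms_def)
  \<comment> \<open>The left and right inverses obtained from the two halves may differ;
    \<open>equivalence_from_one_sided_inverses\<close> reconciles them. Conversely one inverse
    serves on both sides.\<close>
  show ?thesis
    unfolding pre_companion_def left_pre_companion_iff[OF assms(3)]
      right_pre_companion_iff[OF assms(3)]
    using composite_bounds(1)[OF assms(3)] equivalence_from_one_sided_inverses
    by (auto simp: is_equivalence_def)
qed

end
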